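(* Let $k\ge 1$ and $n\ge 3$ be integers, and let $G$ be a complete graph with $|G|\ge n$ whose edges are colored by a Gallai $k$-coloring with color classes $E_1,\ldots,E_k$. Let $q(G)$ denote the number of colors $i\in[k]$ such that the spanning subgraph $H_i$ of $G$ with $V(H_i)=V(G)$ and $E(H_i)=E_i$ has a connected component with at least $n$ vertices. If $|G|\ge (n-1)\cdot q(G)+2n+2$, then $G$ contains a monochromatic cycle $C_{2n}$ (a cycle on $2n$ vertices all of whose edges have the same color).
   Context: A Gallai coloring of a complete graph is an edge-coloring with no rainbow triangle, i.e., no triangle whose three edges receive three distinct colors. A Gallai $k$-coloring is a Gallai coloring using (at most) the colors in $[k]=\{1,\ldots,k\}$. $|G|$ denotes the number of vertices of $G$, and $C_m$ denotes the cycle on $m$ vertices. *)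

theory Defs
  imports "Graph_Theory.Graph_Theory"
begin

(* An undirected simple graph is a symmetric loop-free digraph without parallel arcs (locale
   graph), so each edge uv appears as the two arcs from u to v and from v to u.  An edge-coloring
   is a function on unordered pairs {u, v}; only its values on the edges of the graph matter. *)

definition edge_coloring_in :: "('a, 'b) pre_digraph \<Rightarrow> nat \<Rightarrow> ('a set \<Rightarrow> nat) \<Rightarrow> bool" where
  "edge_coloring_in G k c \<longleftrightarrow> (\<forall>u v. u \<rightarrow>\<^bsub>G\<^esub> v \<longrightarrow> c {u, v} \<in> {1..k})"

definition rainbow_triangle ::
    "('a, 'b) pre_digraph \<Rightarrow> ('a set \<Rightarrow> nat) \<Rightarrow> 'a \<Rightarrow> 'a \<Rightarrow> 'a \<Rightarrow> bool" where
  "rainbow_triangle G c u v w \<longleftrightarrow>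
     u \<rightarrow>\<^bsub>G\<^esub> v \<and> v \<rightarrow>\<^bsub>G\<^esub> w \<and> u \<rightarrow>\<^bsub>G\<^esub> w \<and>
     c {u, v} \<noteq> c {v, w} \<and> c {v, w} \<noteq> c {u, w} \<and> c {u, v} \<noteq> c {u, w}"

definition gallai_coloring :: "('a, 'b) pre_digraph \<Rightarrow> nat \<Rightarrow> ('a set \<Rightarrow> nat) \<Rightarrow> bool" where
  "gallai_coloring G k c \<longleftrightarrow>
     edge_coloring_in G k c \<and> \<not> (\<exists>u v w. rainbow_triangle G c u v w)"

definition color_subgraph ::
    "('a, 'b) pre_digraph \<Rightarrow> ('a set \<Rightarrow> nat) \<Rightarrow> nat \<Rightarrow> ('a, 'b) pre_digraph" where
  "color_subgraph G c i = G\<lparr>arcs := {e \<in> arcs G. c {tail G e, head G e} = i}\<rparr>"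

lemma spanning_color_subgraph:
  assumes "wf_digraph G"
  shows "spanning (color_subgraph G c i) G"
  using assms
  by (auto simp: spanning_def subgraph_def color_subgraph_def compatible_def wf_digraph_def)

lemma arcs_ends_color_subgraph:
  "arcs_ends (color_subgraph G c i) = {(u, v). u \<rightarrow>\<^bsub>G\<^esub> v \<and> c {u, v} = i}"
  by (auto simp: arcs_ends_def arc_to_ends_def color_subgraph_def image_iff)

lemma symmetric_color_subgraph:
  assumes "symmetric G"
  shows "symmetric (color_subgraph G c i)"
  using assms
  by (auto simp: symmetric_def arcs_ends_color_subgraph sym_def insert_commute)

(* The graphs color_subgraph G c i are symmetric, so their strongly connected components are
   exactly their connected components (isolated vertices included). *)

definition num_large_colors ::
    "('a, 'b) pre_digraph \<Rightarrow> nat \<Rightarrow> ('a set \<Rightarrow> nat) \<Rightarrow> nat \<Rightarrow> nat" where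
  "num_large_colors G k c n =
     card {i \<in> {1..k}. \<exists>C \<in> pre_digraph.sccs (color_subgraph G c i). n \<le> card (verts C)}"

(* For m \<ge> 3 a cycle of length m in the sense of pre_digraph.cycle (a closed arc walk on m
   distinct vertices) traverses an undirected C_m.  For m = 2 this would fail: a single edge
   traversed back and forth is also such a cycle. *)

definition monochromatic_cycle ::
    "('a, 'b) pre_digraph \<Rightarrow> nat \<Rightarrow> ('a set \<Rightarrow> nat) \<Rightarrow> nat \<Rightarrow> bool" where
  "monochromatic_cycle G k c m \<longleftrightarrow>
     (\<exists>i \<in> {1..k}. \<exists>p. pre_digraph.cycle (color_subgraph G c i) p \<and> length p = m)"

end

(* Let X be a smallest set with at least n vertices that every outside vertex sees in one colour.
   By Gallai's structure theorem some two colours r, b contain all edges of a cut of X.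
   For every colour i the set S_i of vertices joined to X in colour i has fewer than n vertices, as
   otherwise K_{n,n} contains C_{2n}, and S_i nonempty makes i a large colour.  Deleting all S_i with
   i different from r, b leaves a set Y on which colours r, b form a blow-up of a 2-coloured complete
   graph with parts of fewer than n vertices.  If r and b are both large, then |Y| >= 4n and a Ramsey
   argument for such blow-ups applies: a longest even monochromatic cycle shorter than 2n can be
   extended.  If b, say, is not large, then every component of the complement of colour r in Y
   misses at least n vertices, because a larger one would be connected in colour b; hence colour r
   contains a complete multipartite graph that has a cycle C_{2n}. *)
theory Submission
  imports Defs
begin

section \<open>Cycles\<close>

text \<open>The minimality of \<open>X\<close> is what bounds the parts: inside \<open>X\<close>, a
  component of the colours other than \<open>r\<close> and \<open>b\<close> is again seen in one
  colour by each vertex outside it, and the cut makes it a proper subset of \<open>X\<close>, so it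
  has fewer than \<open>n\<close> vertices. Nothing is known about the colours inside
  \<open>S_r\<close> or \<open>S_b\<close>, but no such component crosses between \<open>X\<close>,
  \<open>S_r\<close> and \<open>S_b\<close>, because an edge between \<open>S_r\<close> and
  \<open>S_b\<close> closes a triangle with edges of colours \<open>r\<close> and \<open>b\<close>
  through \<open>X\<close>.

  The bound \<open>4n\<close> leaves at least \<open>2n + 2\<close> vertices outside an even cycle
  shorter than \<open>2n\<close>, and hence an outside component with at least \<open>n + 3\<close>
  vertices. The obstacle in extending the cycle is parity: an outside path can only be inserted if
  it changes the length by an even amount. Most of the work shows that failing to find a path of the
  right parity in one colour leaves a cycle in the other.\<close>

definition cyclic_list :: "('a \<Rightarrow> 'a \<Rightarrow> bool) \<Rightarrow> 'a list \<Rightarrow> bool" where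
  "cyclic_list R xs \<longleftrightarrow> xs \<noteq> [] \<and> distinct xs \<and> successively R xs \<and> R (last xs) (hd xs)"

definition has_cycle :: "('a \<Rightarrow> 'a \<Rightarrow> bool) \<Rightarrow> nat \<Rightarrow> bool" where
  "has_cycle R L \<longleftrightarrow> (\<exists>xs. cyclic_list R xs \<and> length xs = L)"

text \<open>Indexing the cycle by all natural numbers turns rotations into shifts of the index and
  makes positions such as \<open>i + d\<close> meaningful without reduction; any \<open>L\<close>
  consecutive indices enumerate the cycle once.\<close>

definition periodic_cycle :: "('a \<Rightarrow> 'a \<Rightarrow> bool) \<Rightarrow> nat \<Rightarrow> (nat \<Rightarrow> 'a) \<Rightarrow> bool" where
  "periodic_cycle R L v \<longleftrightarrow> 0 < L \<and> (\<forall>i. R (v i) (v (Suc i))) \<and> (\<forall>i j. v i = v j \<longleftrightarrow> i mod L = j mod L)"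

lemma cyclic_list_winds:
  assumes "cyclic_list R xs"
  shows "periodic_cycle R (length xs) (\<lambda>i. xs ! (i mod length xs))"
proof -
  let ?L = "length xs"
  have L: "0 < ?L" and d: "distinct xs" and s: "successively R xs" and e: "R (last xs) (hd xs)"
    using assms by (auto simp: cyclic_list_def)
  have "R (xs ! (i mod ?L)) (xs ! (Suc i mod ?L))" for i
  proof (cases "Suc (i mod ?L) = ?L")
    case True
    then have "Suc i mod ?L = 0" by (simp add: mod_Suc)
    moreover have "i mod ?L = ?L - 1" using True by simp
    ultimately show ?thesis using e L by (simp add: last_conv_nth hd_conv_nth)
  next
    case False
    then have "Suc i mod ?L = Suc (i mod ?L)" by (simp add: mod_Suc)
    moreover have "Suc (i mod ?L) < ?L" using False L by (metis Suc_lessI mod_less_divisor)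
    ultimately show ?thesis using s by (simp add: successively_conv_nth)
  qed
  moreover have "xs ! (i mod ?L) = xs ! (j mod ?L) \<longleftrightarrow> i mod ?L = j mod ?L" for i j
    using d L by (simp add: nth_eq_iff_index_eq)
  ultimately show ?thesis using L unfolding periodic_cycle_def by blast
qed

lemma cyclic_list_append:
  assumes "xs \<noteq> []" "ys \<noteq> []" "distinct (xs @ ys)" "successively R xs" "successively R ys"
    and "R (last xs) (hd ys)" "R (last ys) (hd xs)"
  shows "cyclic_list R (xs @ ys)"
  using assms unfolding cyclic_list_def successively_append_iff by auto

lemma has_cycle_winds: "has_cycle R L \<Longrightarrow> \<exists>v. periodic_cycle R L v"
  unfolding has_cycle_def using cyclic_list_winds by metis

lemma periodic_cycle_shift:
  assumes "periodic_cycle R L v"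
  shows "periodic_cycle R L (\<lambda>j. v (i + j))"
  using assms by (auto simp: periodic_cycle_def mod_add_eq nat_mod_eq_iff)

lemma periodic_cycle_step: "periodic_cycle R L v \<Longrightarrow> R (v i) (v (Suc i))"
  by (simp add: periodic_cycle_def)

lemma periodic_cycle_add: "periodic_cycle R L v \<Longrightarrow> v (i + L) = v i"
  by (simp add: periodic_cycle_def)

lemma periodic_cycle_inj: "periodic_cycle R L v \<Longrightarrow> inj_on v {a..<a+L}"
proof (rule inj_onI)
  fix i j assume w: "periodic_cycle R L v" and i: "i \<in> {a..<a+L}" and j: "j \<in> {a..<a+L}" and "v i = v j"
  then have m: "i mod L = j mod L" by (simp add: periodic_cycle_def)
  have False if "x < y" "y - x < L" "x mod L = y mod L" for x y :: nat
    using that by (metis less_imp_le mod_eq_dvd_iff_nat nat_dvd_not_less zero_less_diff)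
  from this[of i j] this[of j i] m i j show "i = j" by force
qed

lemma periodic_cycle_range: "periodic_cycle R L v \<Longrightarrow> range v = v ` {0..<L}"
proof -
  assume w: "periodic_cycle R L v"
  have "v i \<in> v ` {0..<L}" for i
    using w by (intro image_eqI[of _ _ "i mod L"]) (auto simp: periodic_cycle_def)
  then show ?thesis by auto
qed

lemma periodic_cycle_card: "periodic_cycle R L v \<Longrightarrow> card (range v) = L"
  using periodic_cycle_range[of R L v] periodic_cycle_inj[of R L v 0] by (simp add: card_image)

lemma periodic_cycle_distinct:
  assumes "periodic_cycle R L v" "distinct is" "set is \<subseteq> {a..<a+L}"
  shows "distinct (map v is)"
  using assms periodic_cycle_inj[OF assms(1), of a] by (auto simp: distinct_map intro: inj_on_subset)

lemma periodic_cycle_arc: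
  assumes "periodic_cycle R L v"
  shows "successively R (map v [a..<b])"
  using assms by (auto simp: successively_conv_nth periodic_cycle_def)

lemma periodic_cycle_chord:
  assumes w: "periodic_cycle R L v" and "R (v i) (v (i + d))" and "1 \<le> d" "d \<le> L"
  shows "has_cycle R (L - d + 1)"
proof -
  let ?xs = "map v [i+d..<Suc (i+L)]"
  have "distinct ?xs" using periodic_cycle_distinct[OF w, of "[i+d..<Suc (i+L)]" "i+d"] assms(3,4) by auto
  moreover have "last ?xs = v i" using periodic_cycle_add[OF w, of i] assms by simp
  moreover have "hd ?xs = v (i+d)" using assms by (simp add: hd_conv_nth nth_append)
  ultimately have "cyclic_list R ?xs" using periodic_cycle_arc[OF w, of "i+d" "Suc (i+L)"] assms unfolding cyclic_list_def by auto
  moreover have "length ?xs = L - d + 1" using assms by simp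
  ultimately show ?thesis unfolding has_cycle_def by blast
qed

text \<open>The extension move: \<open>d\<close> steps of the cycle give way to an outside path.
  Since \<open>length p\<close> counts vertices, both \<open>d\<close> and the parity of that number
  decide whether the new length is even.\<close>

lemma periodic_cycle_detour:
  assumes w: "periodic_cycle R L v" and p: "p \<noteq> []" "distinct p" "successively R p" "set p \<inter> range v = {}"
    and R: "R (v i) (hd p)" "R (last p) (v (i + d))" and d: "1 \<le> d" "d \<le> L"
  shows "has_cycle R (L - d + 1 + length p)"
proof -
  let ?xs = "map v [i+d..<Suc (i+L)]"
  have "distinct ?xs" using periodic_cycle_distinct[OF w, of "[i+d..<Suc (i+L)]" "i+d"] d by auto
  moreover have "last ?xs = v i" using periodic_cycle_add[OF w, of i] d by simp
  moreover have hd: "hd ?xs = v (i+d)" using d by (simp add: hd_conv_nth nth_append)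
  moreover have "hd (?xs @ p) = v (i+d)" using hd d by (subst hd_append2) auto
  moreover have "?xs \<noteq> []" using d by simp
  ultimately have "cyclic_list R (?xs @ p)" using periodic_cycle_arc[OF w, of "i+d" "Suc (i+L)"] p R
    unfolding cyclic_list_def successively_append_iff distinct_append by (auto simp del: upt_Suc)
  moreover have "length (?xs @ p) = L - d + 1 + length p" using d by simp
  ultimately show ?thesis unfolding has_cycle_def by blast
qed

text \<open>The cycle is \<open>as ! 0, bs ! 0, as ! 1, bs ! 1, ...\<close>. Asking only for the
  edges it uses makes the lemma applicable to graphs that are merely close to complete
  bipartite.\<close>

lemma has_cycle_zigzag:
  assumes len: "length as = m" "length bs = m" and m: "1 \<le> m" and dist: "distinct (as @ bs)"
    and ab: "\<And>i. i < m \<Longrightarrow> R (as ! i) (bs ! i)"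
    and ba: "\<And>i. Suc i < m \<Longrightarrow> R (bs ! i) (as ! Suc i)"
    and close: "R (bs ! (m - 1)) (as ! 0)"
  shows "has_cycle R (2 * m)"
proof -
  define z where "z i = (if even i then as ! (i div 2) else bs ! (i div 2))" for i :: nat
  let ?xs = "map z [0..<2 * m]"
  have z_even: "z (2 * i) = as ! i" and z_odd: "z (Suc (2 * i)) = bs ! i" for i
    by (auto simp: z_def)
  have "inj_on z {0..<2*m}"
  proof (rule inj_onI)
    fix i j assume ij: "i \<in> {0..<2*m}" "j \<in> {0..<2*m}" "z i = z j"
    have lt: "i div 2 < m" "j div 2 < m" using ij by auto
    have das: "distinct as" "distinct bs" "set as \<inter> set bs = {}" using dist by auto
    have ne: "as ! k \<noteq> bs ! l" if "k < m" "l < m" for k l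
      using das(3) that len by (metis disjoint_iff nth_mem)
    show "i = j"
    proof (cases "even i"; cases "even j")
      assume "even i" "even j"
      then have "i div 2 = j div 2" using ij(3) lt das len by (simp add: z_def nth_eq_iff_index_eq)
      then show ?thesis using \<open>even i\<close> \<open>even j\<close> by (metis dvd_mult_div_cancel)
    next
      assume "odd i" "odd j"
      then have "i div 2 = j div 2" using ij(3) lt das len by (simp add: z_def nth_eq_iff_index_eq)
      then show ?thesis using \<open>odd i\<close> \<open>odd j\<close> by (metis odd_two_times_div_two_succ)
    qed (use ij(3) ne lt in \<open>auto simp: z_def split: if_splits\<close>, metis)
  qed
  then have "distinct ?xs" by (simp add: distinct_map)
  moreover have "R (z i) (z (Suc i))" if "Suc i < 2 * m" for i
  proof (cases "even i")
    case True
    then obtain k where "i = 2 * k" by blast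
    then show ?thesis using ab[of k] that by (simp add: z_even z_odd)
  next
    case False
    then obtain k where k: "i = Suc (2 * k)" by (auto elim: oddE)
    have "z (Suc i) = as ! Suc k" using z_even[of "Suc k"] k by simp
    then show ?thesis using ba[of k] that by (simp add: z_odd k)
  qed
  then have "successively R ?xs" by (auto simp: successively_conv_nth)
  moreover have "last ?xs = bs ! (m - 1)"
  proof -
    obtain k where "m = Suc k" using m by (cases m) auto
    then show ?thesis using z_odd[of k] by (simp add: last_conv_nth nth_append)
  qed
  moreover have "hd ?xs = as ! 0" using m z_even[of 0] by (simp add: hd_conv_nth)
  ultimately have "cyclic_list R ?xs" using m close unfolding cyclic_list_def by auto
  then show ?thesis unfolding has_cycle_def by (intro exI[of _ ?xs]) simp
qed

section \<open>Multipartite graphs and connectivity\<close>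

lemma ex_distinct_list:
  assumes "m \<le> card A"
  shows "\<exists>xs. distinct xs \<and> length xs = m \<and> set xs \<subseteq> A"
proof -
  obtain S where "S \<subseteq> A" "card S = m" "finite S" using obtain_subset_with_card_n[OF assms] by blast
  then show ?thesis by (metis distinct_card finite_distinct_list)
qed

lemma has_cycle_bipartite:
  assumes "A \<inter> B = {}" "m \<le> card A" "m \<le> card B" "1 \<le> m"
    and "\<And>a b. a \<in> A \<Longrightarrow> b \<in> B \<Longrightarrow> R a b \<and> R b a"
  shows "has_cycle R (2 * m)"
proof -
  obtain as where as: "distinct as" "length as = m" "set as \<subseteq> A" using ex_distinct_list assms by blast
  obtain bs where bs: "distinct bs" "length bs = m" "set bs \<subseteq> B" using ex_distinct_list assms by blast
  have mem: "as ! i \<in> A" "bs ! i \<in> B" if "i < m" for i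
    using as bs that by (metis nth_mem subsetD)+
  show ?thesis
  proof (rule has_cycle_zigzag[OF as(2) bs(2) \<open>1 \<le> m\<close>])
    show "distinct (as @ bs)" using as bs assms(1) by auto
  qed (use assms(4,5) mem in simp_all)
qed

text \<open>If some part has at least \<^term>\<open>m\<close> vertices, take a complete bipartite graph.  Otherwise
  list the vertices part by part: positions at distance at least \<^term>\<open>m - 1\<close> lie in different
  parts, so \<open>x\<^sub>0, x\<^sub>m, x\<^sub>1, x\<^bsub>m+1\<^esub>, \<dots>\<close> is a cycle.\<close>

lemma has_cycle_multipartite:
  fixes l :: "'a \<Rightarrow> nat"
  assumes fin: "finite W" and W: "2 * m \<le> card W" and m: "1 \<le> m"
    and out: "\<And>u. u \<in> W \<Longrightarrow> m \<le> card {v \<in> W. l v \<noteq> l u}"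
    and R: "\<And>u v. u \<in> W \<Longrightarrow> v \<in> W \<Longrightarrow> l u \<noteq> l v \<Longrightarrow> R u v"
  shows "has_cycle R (2 * m)"
proof (cases "\<exists>u\<in>W. m \<le> card {v \<in> W. l v = l u}")
  case True
  then obtain u where u: "u \<in> W" "m \<le> card {v \<in> W. l v = l u}" by blast
  show ?thesis
    by (rule has_cycle_bipartite[OF _ u(2) out[OF u(1)] m]) (auto intro: R)
next
  case False
  obtain ws where ws: "set ws = W" "distinct ws" using finite_distinct_list[OF fin] by blast
  define xs where "xs = sort_key l ws"
  have xs: "set xs = W" "distinct xs" "sorted (map l xs)" by (auto simp: xs_def ws)
  have len: "2 * m \<le> length xs" using W xs distinct_card by metis
  have sep: "l (xs ! i) \<noteq> l (xs ! j)" if ij: "i \<le> j" "m - 1 \<le> j - i" "j < length xs" for i j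
  proof
    assume eq: "l (xs ! i) = l (xs ! j)"
    have between: "l (xs ! k) = l (xs ! j)" if "k \<in> {i..j}" for k
    proof -
      have "l (xs ! i) \<le> l (xs ! k)" "l (xs ! k) \<le> l (xs ! j)"
        using that ij xs(3) by (auto simp: sorted_iff_nth_mono)
      then show ?thesis using eq by simp
    qed
    have "(!) xs ` {i..j} \<subseteq> {v \<in> W. l v = l (xs ! j)}"
    proof (rule image_subsetI)
      fix k assume k: "k \<in> {i..j}"
      then have "xs ! k \<in> W" using ij(3) xs(1) nth_mem[of k xs] by simp
      then show "xs ! k \<in> {v \<in> W. l v = l (xs ! j)}" using between[OF k] by simp
    qed
    then have "card ((!) xs ` {i..j}) \<le> card {v \<in> W. l v = l (xs ! j)}"
      using fin by (intro card_mono) auto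
    moreover have "card ((!) xs ` {i..j}) = Suc (j - i)"
      using ij xs(2) by (subst card_image) (auto simp: inj_on_def nth_eq_iff_index_eq Suc_diff_le)
    moreover have "xs ! j \<in> W" using ij xs(1) by auto
    ultimately show False using False ij by force
  qed
  have Rij: "R (xs ! i) (xs ! j)" if "i < length xs" "j < length xs" "i + (m - 1) \<le> j \<or> j + (m - 1) \<le> i" for i j
  proof (rule R)
    show "xs ! i \<in> W" "xs ! j \<in> W" using that xs(1) nth_mem by blast+
    have "i \<le> j \<and> m - 1 \<le> j - i \<or> j \<le> i \<and> m - 1 \<le> i - j" using that(3) by linarith
    then show "l (xs ! i) \<noteq> l (xs ! j)" using sep[of i j] sep[of j i] that(1,2) by metis
  qed
  show ?thesis
  proof (rule has_cycle_zigzag[of "take m xs" m "take m (drop m xs)"])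
    have "take m xs @ take m (drop m xs) = take (m + m) xs" by (simp add: take_add)
    then show "distinct (take m xs @ take m (drop m xs))" using xs(2) by simp
  next
    fix i assume "i < m"
    then have "R (xs ! i) (xs ! (m + i))" using len by (intro Rij) linarith+
    then show "R (take m xs ! i) (take m (drop m xs) ! i)" using \<open>i < m\<close> len by simp
  next
    \<comment> \<open>This is the tight case: positions \<open>m + i\<close> and
      \<open>i + 1\<close> are exactly \<open>m - 1\<close> apart.\<close>
    fix i assume "Suc i < m"
    then have "R (xs ! (m + i)) (xs ! Suc i)" using len by (intro Rij) linarith+
    then show "R (take m (drop m xs) ! i) (take m xs ! Suc i)" using \<open>Suc i < m\<close> len by simp
  next
    have "R (xs ! (m + (m - 1))) (xs ! 0)" using len m by (intro Rij) linarith+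
    then show "R (take m (drop m xs) ! (m - 1)) (take m xs ! 0)" using len m by simp
  qed (use len m in auto)
qed

text \<open>Reachability by walks inside \<open>X\<close>. It is reflexive even outside
  \<open>X\<close>, so classes are always written with an explicit \<open>w \<in> X\<close>.\<close>

definition linked :: "('a \<Rightarrow> 'a \<Rightarrow> bool) \<Rightarrow> 'a set \<Rightarrow> 'a \<Rightarrow> 'a \<Rightarrow> bool" where
  "linked E X = (\<lambda>x y. x \<in> X \<and> y \<in> X \<and> E x y)\<^sup>*\<^sup>*"

lemma linked_refl [simp]: "linked E X u u"
  by (simp add: linked_def)

lemma linked_step: "x \<in> X \<Longrightarrow> y \<in> X \<Longrightarrow> E x y \<Longrightarrow> linked E X x y"
  by (auto simp: linked_def)

lemma linked_trans: "linked E X u v \<Longrightarrow> linked E X v w \<Longrightarrow> linked E X u w"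
  unfolding linked_def by (rule rtranclp_trans)

lemma linked_sym:
  assumes "\<And>x y. E x y \<Longrightarrow> E y x" and "linked E X u v"
  shows "linked E X v u"
proof -
  have "symp (\<lambda>x y. x \<in> X \<and> y \<in> X \<and> E x y)" using assms(1) by (auto intro: sympI)
  then show ?thesis using assms(2) unfolding linked_def by (metis symp_rtranclp sympD)
qed

lemma linked_in: "linked E X u v \<Longrightarrow> u \<in> X \<longleftrightarrow> v \<in> X"
  unfolding linked_def by (induction rule: rtranclp_induct) auto

lemma linked_mono:
  assumes "linked E X u v" "\<And>x y. x \<in> X \<Longrightarrow> y \<in> X \<Longrightarrow> E x y \<Longrightarrow> linked F Y x y"
  shows "linked F Y u v"
  using assms(1) unfolding linked_def[of E]
proof (induction rule: rtranclp_induct)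
  case (step y z)
  then show ?case using assms(2) linked_trans by metis
qed simp

definition spath :: "('a \<Rightarrow> 'a \<Rightarrow> bool) \<Rightarrow> 'a set \<Rightarrow> 'a \<Rightarrow> 'a list \<Rightarrow> 'a \<Rightarrow> bool" where
  "spath E X u p w \<longleftrightarrow>
     p \<noteq> [] \<and> distinct p \<and> set p \<subseteq> X \<and> successively E p \<and> hd p = u \<and> last p = w"

lemma linked_spath:
  assumes "linked E X u w" "u \<in> X"
  shows "\<exists>p. spath E X u p w"
  using assms(1) unfolding linked_def
proof (induction rule: rtranclp_induct)
  case base
  show ?case using assms(2) by (intro exI[of _ "[u]"]) (simp add: spath_def)
next
  case (step y z)
  then obtain p where p: "spath E X u p y" by blast
  show ?case
  proof (cases "z \<in> set p")
    case True
    then obtain p1 p2 where "p = p1 @ z # p2" by (meson split_list)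
    then have split: "p = (p1 @ [z]) @ p2" by simp
    then have "successively E (p1 @ [z])"
      using p unfolding spath_def split by (metis successively_append_iff)
    moreover have "hd (p1 @ [z]) = u" using p split by (cases p1) (auto simp: spath_def)
    ultimately have "spath E X u (p1 @ [z]) z"
      using p split by (auto simp: spath_def)
    then show ?thesis by blast
  next
    case False
    then have "spath E X u (p @ [z]) z"
      using p step.hyps(2) by (auto simp: spath_def successively_append_iff)
    then show ?thesis by blast
  qed
qed

text \<open>Vertices in different components of \<open>E\<close> are not \<open>E\<close>-adjacent,
  hence \<open>R\<close>-adjacent, so the components are the parts of a complete multipartite graph
  in \<open>R\<close>.\<close>

lemma has_cycle_components:
  assumes fin: "finite W" and W: "2 * m \<le> card W" and m: "1 \<le> m"
    and E: "\<And>x y. E x y \<Longrightarrow> E y x"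
    and out: "\<And>u. u \<in> W \<Longrightarrow> m \<le> card {v \<in> W. \<not> linked E W u v}"
    and R: "\<And>u v. u \<in> W \<Longrightarrow> v \<in> W \<Longrightarrow> u \<noteq> v \<Longrightarrow> \<not> E u v \<Longrightarrow> R u v"
  shows "has_cycle R (2 * m)"
proof -
  define cl where "cl u = Collect (linked E W u)" for u
  have cl: "cl v = cl u \<longleftrightarrow> linked E W u v" for u v
  proof
    assume "cl v = cl u"
    then have "v \<in> cl u" unfolding cl_def by (metis linked_refl mem_Collect_eq)
    then show "linked E W u v" by (simp add: cl_def)
  next
    assume uv: "linked E W u v"
    have vu: "linked E W v u" by (rule linked_sym[OF E uv])
    show "cl v = cl u"
      unfolding cl_def using linked_trans[OF uv] linked_trans[OF vu] by blast
  qed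
  \<comment> \<open>The multipartite lemma sorts vertices by label, so the components are
    numbered.\<close>
  define l where "l u = to_nat_on (cl ` W) (cl u)" for u
  have "inj_on (to_nat_on (cl ` W)) (cl ` W)" using fin by (intro inj_on_to_nat_on countable_finite) auto
  then have l: "l v = l u \<longleftrightarrow> linked E W u v" if "u \<in> W" "v \<in> W" for u v
    unfolding l_def cl[symmetric] using that by (auto dest: inj_onD)
  show ?thesis
  proof (rule has_cycle_multipartite[OF fin W m, of l])
    fix u assume u: "u \<in> W"
    then have "{v \<in> W. l v \<noteq> l u} = {v \<in> W. \<not> linked E W u v}"
      using l by auto
    then show "m \<le> card {v \<in> W. l v \<noteq> l u}"
      using out[OF u] by simp
  next
    fix u v assume uv: "u \<in> W" "v \<in> W" "l u \<noteq> l v"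
    then have "\<not> linked E W v u" using l by blast
    then have "\<not> E v u" "u \<noteq> v" using linked_step[of v W u E] uv by auto
    then show "R u v" using R[OF uv(1,2)] E by blast
  qed
qed

lemma linked_induct [consumes 1, case_names refl step]:
  assumes "linked E X u v" and "P u"
    and "\<And>y z. linked E X u y \<Longrightarrow> y \<in> X \<Longrightarrow> z \<in> X \<Longrightarrow> E y z \<Longrightarrow> P y \<Longrightarrow> P z"
  shows "P v"
  using assms(1) unfolding linked_def
proof (induction rule: rtranclp_induct)
  case (step y z)
  then show ?case using assms(3)[of y z] unfolding linked_def by blast
qed (rule assms(2))

lemma linked_exit:
  assumes "linked E X x w" "x \<in> N" "w \<notin> N"
  shows "\<exists>p q. p \<in> N \<and> q \<notin> N \<and> p \<in> X \<and> q \<in> X \<and> E p q \<and> linked E X x p \<and> linked E X x q"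
  using assms(1,3)
proof (induction rule: linked_induct)
  case (step y z)
  have "linked E X x z" using step linked_trans linked_step by metis
  then show ?case using step by blast
qed (use assms(2) in blast)

lemma linked_restrict:
  assumes "linked E X u v"
  shows "linked E {w \<in> X. linked E X u w} u v"
  using assms
proof (induction rule: linked_induct)
  case (step y z)
  have "linked E X u z" using step linked_trans linked_step by metis
  then have "linked E {w \<in> X. linked E X u w} y z" using step by (intro linked_step) auto
  then show ?case using step linked_trans by metis
qed simp

text \<open>The two chords bypass \<open>v (i + 1)\<close> and \<open>v (i + t + 1)\<close>; the
  bounds on \<open>t\<close> keep the two remaining arcs nonempty and disjoint.\<close>

lemma periodic_cycle_two_chords:
  assumes w: "periodic_cycle R L v" and R: "R (v i) (v (i + 2))" "R (v (i + t)) (v (i + t + 2))"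
    and t: "2 \<le> t" "t + 2 \<le> L"
  shows "has_cycle R (L - 2)"
proof -
  let ?xs = "map v [i+2..<i+t+1]" and ?ys = "map v [i+t+2..<Suc (i+L)]"
  have "distinct (map v ([i+2..<i+t+1] @ [i+t+2..<Suc (i+L)]))"
    using t by (intro periodic_cycle_distinct[OF w, of _ "Suc i"]) auto
  then have "distinct (?xs @ ?ys)" by (simp only: map_append)
  moreover have "last ?ys = v i" "last ?xs = v (i + t)" using periodic_cycle_add[OF w, of i] t by simp_all
  moreover have "hd ?xs = v (i+2)" "hd ?ys = v (i+t+2)" using t by (simp_all add: hd_map del: upt_Suc)
  moreover have "?xs \<noteq> []" "?ys \<noteq> []" using t by simp_all
  ultimately have "cyclic_list R (?xs @ ?ys)"
    using periodic_cycle_arc[OF w] R by (intro cyclic_list_append) (simp_all del: upt_Suc)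
  moreover have "length (?xs @ ?ys) = L - 2" using t by simp
  ultimately show ?thesis unfolding has_cycle_def by blast
qed

section \<open>Two-coloured blow-ups\<close>

text \<open>The parts of the blow-up are the classes of the non-adjacency relation.\<close>

locale blowup =
  fixes V :: "'a set" and R B :: "'a \<Rightarrow> 'a \<Rightarrow> bool" and n :: nat
  assumes finV: "finite V" and n3: "3 \<le> n"
    and R_sym: "R u v \<Longrightarrow> R v u" and B_sym: "B u v \<Longrightarrow> B v u"
    and R_irrefl: "\<not> R u u" and B_irrefl: "\<not> B u u"
    and R_in: "R u v \<Longrightarrow> u \<in> V" and B_in: "B u v \<Longrightarrow> u \<in> V"
    and R_twin: "\<lbrakk>u \<in> V; v \<in> V; \<not> R u v; \<not> B u v\<rbrakk> \<Longrightarrow> R u w \<longleftrightarrow> R v w"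
    and B_twin: "\<lbrakk>u \<in> V; v \<in> V; \<not> R u v; \<not> B u v\<rbrakk> \<Longrightarrow> B u w \<longleftrightarrow> B v w"
    and small: "u \<in> V \<Longrightarrow> card {v \<in> V. \<not> R u v \<and> \<not> B u v} < n"
begin

lemma swap: "blowup V B R n"
proof
  show "card {v \<in> V. \<not> B u v \<and> \<not> R u v} < n" if "u \<in> V" for u
    using small[OF that] by (simp add: conj_commute)
  show "B u w \<longleftrightarrow> B v w" if "u \<in> V" "v \<in> V" "\<not> B u v" "\<not> R u v" for u v w
    by (rule B_twin[OF that(1,2,4,3)])
  show "R u w \<longleftrightarrow> R v w" if "u \<in> V" "v \<in> V" "\<not> B u v" "\<not> R u v" for u v w
    by (rule R_twin[OF that(1,2,4,3)])
qed (fact finV, fact n3, erule B_sym, erule R_sym, rule B_irrefl, rule R_irrefl, erule B_in, erule R_in)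

lemma periodic_cycle_in: "periodic_cycle R L v \<Longrightarrow> v i \<in> V"
  by (rule R_in, erule periodic_cycle_step)

text \<open>Two vertices that are not blue-adjacent are red-adjacent or lie in one part. In the
  latter case some walk of non-blue steps leaves that part, which is smaller than \<open>K\<close>,
  by a step from \<open>a\<close> to \<open>b\<close>. Since \<open>a\<close> is a twin of
  \<open>p\<close> and \<open>q\<close>, the vertex \<open>b\<close> is red-adjacent to both and
  connects them.\<close>

lemma component_linked:
  assumes W: "W \<subseteq> V" and u: "u \<in> W"
    and K: "K = {v \<in> W. linked (\<lambda>x y. \<not> B x y) W u v}" "n \<le> card K"
    and xy: "x \<in> K" "y \<in> K"
  shows "linked R K x y"
proof -
  let ?E = "\<lambda>x y. \<not> B x y"
  have E: "?E x y \<Longrightarrow> ?E y x" for x y using B_sym by blast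
  have lin: "linked ?E W p q" if "p \<in> K" "q \<in> K" for p q
  proof -
    have "linked ?E W u p" "linked ?E W u q" using that K(1) by auto
    then show ?thesis using linked_trans[OF linked_sym[of ?E W u p]] E by metis
  qed
  have stay: "q \<in> K" if "p \<in> K" "linked ?E W p q" for p q
  proof -
    have "linked ?E W u q" using that K(1) linked_trans[of ?E W u p q] by simp
    then show ?thesis using that K(1) linked_in[of ?E W p q] by simp
  qed
  have KV: "K \<subseteq> V" using K W by blast
  have step: "linked R K p q" if pq: "p \<in> K" "q \<in> K" "\<not> B p q" for p q
  proof (cases "R p q")
    case True
    then show ?thesis using pq linked_step[of p K q R] by simp
  next
    case False
    let ?N = "{v \<in> V. \<not> R p v \<and> \<not> B p v}"
    have "card ?N < card K" using small[of p] pq K(2) KV by fastforce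
    then have "\<not> K \<subseteq> ?N" using card_mono[of ?N K] finV by auto
    then obtain w where w: "w \<in> K" "w \<notin> ?N" by blast
    have "p \<in> ?N" using pq KV R_irrefl B_irrefl by auto
    obtain a b where ab: "a \<in> ?N" "b \<notin> ?N" "\<not> B a b" "linked ?E W p b"
      using linked_exit[OF lin[OF pq(1) w(1)] \<open>p \<in> ?N\<close> w(2)] by blast
    have b: "b \<in> K" using stay[OF pq(1) ab(4)] .
    have "R p b \<or> B p b" using ab(2) b KV by blast
    moreover have "B p b \<longleftrightarrow> B a b" using B_twin[of p a b] ab(1) pq KV by blast
    ultimately have "R p b" using ab(3) by blast
    moreover have "R q b" using R_twin[of p q b] False pq KV \<open>R p b\<close> by blast
    ultimately show ?thesis
      using linked_trans[of R K p b q] linked_step[of p K b R] linked_step[of b K q R] pq b R_sym by blast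
  qed
  have "linked ?E {w \<in> W. linked ?E W x w} x y" using linked_restrict[OF lin[OF xy]] .
  then show ?thesis
  proof (rule linked_mono)
    fix p q assume "p \<in> {w \<in> W. linked ?E W x w}" "q \<in> {w \<in> W. linked ?E W x w}" "\<not> B p q"
    then show "linked R K p q" using step stay xy(1) by blast
  qed
qed

text \<open>Let \<open>v\<close> be a red cycle of length \<open>2l\<close> with no red cycle two shorter.  No chord
  \<open>v\<^sub>iv\<^bsub>i+3\<^esub>\<close> is red, and two red chords \<open>v\<^sub>iv\<^bsub>i+2\<^esub>\<close>, \<open>v\<^sub>jv\<^bsub>j+2\<^esub>\<close> must be equal or
  consecutive.  Up to rotation all chords needed for the blue cycle
  \<open>v\<^sub>2, v\<^sub>4, \<dots>, v\<^bsub>2l-2\<^esub>, v\<^sub>1, v\<^bsub>2l-1\<^esub>, v\<^bsub>2l-3\<^esub>, \<dots>, v\<^sub>5\<close> are then blue.\<close>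

lemma descent:
  assumes "has_cycle R (2 * l)" "4 \<le> l"
  shows "has_cycle R (2 * l - 2) \<or> has_cycle B (2 * l - 2)"
proof (rule ccontr)
  assume no: "\<not> (has_cycle R (2 * l - 2) \<or> has_cycle B (2 * l - 2))"
  obtain v where w: "periodic_cycle R (2 * l) v" using assms(1) has_cycle_winds by blast
  have vV: "v i \<in> V" for i using periodic_cycle_in[OF w] .
  have Rs: "R (v i) (v (Suc i))" for i using periodic_cycle_step[OF w] .
  have no3: "\<not> R (v i) (v (i + 3))" for i
  proof -
    have "2 * l - 3 + 1 = 2 * l - 2" using assms(2) by simp
    then show ?thesis using periodic_cycle_chord[OF w, of i 3] no assms(2) by auto
  qed
  have no2: "\<not> (R (v i) (v (i + 2)) \<and> R (v (i + t)) (v (i + t + 2)))" if "2 \<le> t" "t \<le> 2 * l - 2" for i t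
  proof -
    have "t + 2 \<le> 2 * l" using that assms(2) by linarith
    then show ?thesis using periodic_cycle_two_chords[OF w, of i t] no that(1) by blast
  qed
  \<comment> \<open>Non-adjacent vertices are twins. If \<open>v i\<close> and
    \<open>v (i + 2)\<close> were twins, the red edge from \<open>v (i + 2)\<close> to
    \<open>v (i + 3)\<close> would yield a forbidden red 3-chord; \<open>B3\<close> uses the same
    edge with \<open>v i\<close> and \<open>v (i + 3)\<close> as twins.\<close>
  have B2: "B (v i) (v (i + 2))" if "\<not> R (v i) (v (i + 2))" for i
  proof (rule ccontr)
    assume "\<not> B (v i) (v (i + 2))"
    then have "R (v i) (v (i + 3)) \<longleftrightarrow> R (v (i + 2)) (v (i + 3))" using R_twin vV that by blast
    then show False using Rs[of "i + 2"] no3[of i] by (simp add: numeral_eq_Suc)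
  qed
  have B3: "B (v i) (v (i + 3))" if "\<not> R (v i) (v (i + 2))" for i
  proof (rule ccontr)
    assume "\<not> B (v i) (v (i + 3))"
    then have "R (v i) (v (i + 2)) \<longleftrightarrow> R (v (i + 3)) (v (i + 2))" using R_twin vV no3 by blast
    then show False using Rs[of "i + 2"] that R_sym by (simp add: numeral_eq_Suc)
  qed
  have vL: "v (i + 2 * l) = v i" for i using periodic_cycle_add[OF w] .
  \<comment> \<open>With a suitable origin, only the 2-chords starting at \<open>i\<close> and
    \<open>i + 1\<close> can be red.\<close>
  have "\<exists>i. \<forall>s. 2 \<le> s \<and> s \<le> 2 * l - 1 \<longrightarrow> \<not> R (v (i + s)) (v (i + s + 2))"
  proof (cases "\<exists>j. R (v j) (v (j + 2))")
    case True
    then obtain j where j: "R (v j) (v (j + 2))" by blast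
    show ?thesis
    proof (cases "R (v (j + (2 * l - 1))) (v (j + (2 * l - 1) + 2))")
      case True
      let ?i = "j + (2 * l - 1)"
      have "\<not> R (v (?i + s)) (v (?i + s + 2))" if s: "2 \<le> s" "s \<le> 2 * l - 1" for s
      proof (cases "s \<le> 2 * l - 2")
        case True
        then show ?thesis using no2[of s ?i] s \<open>R (v ?i) (v (?i + 2))\<close> by blast
      next
        case False
        then have "?i + s = j + (2 * l - 2) + 2 * l" using s assms(2) by simp
        then have "v (?i + s) = v (j + (2 * l - 2))" "v (?i + s + 2) = v (j + (2 * l - 2) + 2)"
          using vL[of "j + (2 * l - 2)"] vL[of "j + (2 * l - 2) + 2"] by (simp_all add: algebra_simps)
        then show ?thesis using no2[of "2 * l - 2" j] j assms(2) by simp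
      qed
      then show ?thesis by blast
    next
      case False
      have "\<not> R (v (j + s)) (v (j + s + 2))" if s: "2 \<le> s" "s \<le> 2 * l - 1" for s
      proof (cases "s = 2 * l - 1")
        case False
        then show ?thesis using no2[of s j] s j by simp
      qed (use False in blast)
      then show ?thesis by blast
    qed
  qed blast
  then obtain i where i: "\<And>s. 2 \<le> s \<Longrightarrow> s \<le> 2 * l - 1 \<Longrightarrow> \<not> R (v (i + s)) (v (i + s + 2))" by blast
  define u where "u s = v (i + s)" for s
  have u2: "B (u s) (u (s + 2))" if "2 \<le> s" "s \<le> 2 * l - 1" for s
    using B2[OF i[OF that]] by (simp add: u_def add.assoc)
  have u3: "B (u s) (u (s + 3))" if "2 \<le> s" "s \<le> 2 * l - 1" for s
    using B3[OF i[OF that]] by (simp add: u_def add.assoc)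
  have wu: "periodic_cycle R (2 * l) u" using periodic_cycle_shift[OF w, of i] unfolding u_def .
  \<comment> \<open>Index \<open>2 * l + 1\<close> stands for position 1, so that all indices lie in
    the window from \<open>2\<close> to \<open>2 * l + 1\<close>. Positions \<open>3\<close> and
    \<open>2 * l\<close> are left out.\<close>
  define xs where "xs = map u (map (\<lambda>t. 2 * t) [1..<l])"
  define ys where "ys = map u (map (\<lambda>t. 2 * t + 1) [2..<Suc l])"
  have "distinct (map u (map (\<lambda>t. 2 * t) [1..<l] @ rev (map (\<lambda>t. 2 * t + 1) [2..<Suc l])))"
  proof (rule periodic_cycle_distinct[OF wu])
    show "distinct (map (\<lambda>t. 2 * t) [1..<l] @ rev (map (\<lambda>t. 2 * t + 1) [2..<Suc l]))"
      by (auto simp: distinct_map inj_on_def simp del: upt_Suc) presburger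
    show "set (map (\<lambda>t. 2 * t) [1..<l] @ rev (map (\<lambda>t. 2 * t + 1) [2..<Suc l])) \<subseteq> {2..<2+2*l}"
      by auto
  qed
  then have d: "distinct (xs @ rev ys)" by (simp add: xs_def ys_def rev_map del: upt_Suc)
  have "successively B xs"
    unfolding xs_def successively_conv_nth using u2 by (auto simp: algebra_simps)
  moreover have "successively B ys"
    unfolding ys_def successively_conv_nth using u2 by (auto simp: algebra_simps simp del: upt_Suc)
  then have "successively B (rev ys)" using B_sym by (auto elim: successively_mono)
  moreover have ne: "xs \<noteq> []" "ys \<noteq> []" using assms(2) by (auto simp: xs_def ys_def)
  have ends: "hd xs = u 2" "last xs = u (2 * l - 2)" "hd ys = u 5" "last ys = u (2 * l + 1)"
    using assms(2) by (auto simp: xs_def ys_def hd_map last_map algebra_simps simp del: upt_Suc)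
       (simp_all add: numeral_2_eq_2)
  moreover have "B (u 2) (u 5)" using u3[of 2] assms(2) by simp
  moreover have "B (u (2 * l - 2)) (u (2 * l + 1))"
  proof -
    have "2 * l - 2 + 3 = 2 * l + 1" using assms(2) by simp
    moreover have "2 \<le> 2 * l - 2" "2 * l - 2 \<le> 2 * l - 1" using assms(2) by simp_all
    ultimately show ?thesis using u3 by metis
  qed
  ultimately have "cyclic_list B (xs @ rev ys)"
    using d B_sym ne by (intro cyclic_list_append) (simp_all add: hd_rev last_rev)
  moreover have "length (xs @ rev ys) = 2 * l - 2" using assms(2) by (simp add: xs_def ys_def)
  ultimately show False using no unfolding has_cycle_def by blast
qed

end

section \<open>Parities of paths in a connected set\<close>

locale linked_set =
  fixes E :: "'a \<Rightarrow> 'a \<Rightarrow> bool" and K :: "'a set"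
  assumes E_sym: "E x y \<Longrightarrow> E y x"
    and lk: "x \<in> K \<Longrightarrow> y \<in> K \<Longrightarrow> linked E K x y"
begin

text \<open>\<^term>\<open>b\<close> is true for paths with an odd number of edges, as the length of the list counts vertices.\<close>

definition parity_path :: "bool \<Rightarrow> 'a \<Rightarrow> 'a \<Rightarrow> bool" where
  "parity_path b u w \<longleftrightarrow> (\<exists>p. spath E K u p w \<and> even (length p) = b)"

lemma spath_rev: "spath E K u p w \<Longrightarrow> spath E K w (rev p) u"
  unfolding spath_def by (auto simp: hd_rev last_rev E_sym elim: successively_mono)

lemma parity_path_sym: "parity_path b u w \<Longrightarrow> parity_path b w u"
  unfolding parity_path_def using spath_rev by fastforce

lemma parity_path_ex: "u \<in> K \<Longrightarrow> w \<in> K \<Longrightarrow> \<exists>b. parity_path b u w"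
  unfolding parity_path_def using linked_spath[OF lk] by blast

lemma parity_path_edge:
  assumes "u \<in> K" "w \<in> K" "E u w" "u \<noteq> w"
  shows "parity_path True u w"
proof -
  have "spath E K u [u, w] w" using assms by (simp add: spath_def)
  then show ?thesis unfolding parity_path_def by force
qed

text \<open>Follow a path from \<^term>\<open>w\<close> to the first vertex it shares with the given path.\<close>

lemma tripod:
  assumes "parity_path b u z" "w \<in> K"
  shows "\<exists>b1 b2. parity_path b1 u w \<and> parity_path b2 w z \<and> (b \<longleftrightarrow> b1 \<noteq> b2)"
proof -
  obtain p where p: "spath E K u p z" "even (length p) = b" using assms(1) unfolding parity_path_def by blast
  have "u \<in> K" "u \<in> set p" using p(1) by (auto simp: spath_def)
  then obtain r where r: "spath E K w r u" using linked_spath[OF lk[OF assms(2)]] assms(2) by blast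
  have "u \<in> set r" using r by (auto simp: spath_def)
  then have "\<exists>x \<in> set r. x \<in> set p" using \<open>u \<in> set p\<close> by blast
  then obtain r1 q r2 where q: "r = r1 @ q # r2" "q \<in> set p" "\<forall>y \<in> set r1. y \<notin> set p"
    using split_list_first_prop[of r "\<lambda>x. x \<in> set p"] by blast
  obtain a c where ac: "p = a @ q # c" using q(2) by (meson split_list)
  let ?p1 = "(a @ [q]) @ rev r1" and ?p2 = "(r1 @ [q]) @ c"
  have sr: "successively E ((r1 @ [q]) @ r2)" and sp: "successively E ((a @ [q]) @ c)"
      "successively E (a @ (q # c))"
    using r p(1) by (simp_all add: spath_def q(1) ac)
  have s: "successively E (r1 @ [q])" "successively E (a @ [q])" "successively E (q # c)"
    using sr sp unfolding successively_append_iff by simp_all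
  have "successively (\<lambda>x y. E y x) (r1 @ [q])"
    by (rule successively_mono[OF s(1)]) (rule E_sym)
  then have "successively E (rev (r1 @ [q]))" by (simp only: successively_rev)
  then have sq: "successively E (q # rev r1)" by simp
  have "spath E K u ?p1 w"
    unfolding spath_def
  proof (intro conjI)
    have "successively E (a @ (q # rev r1))"
      using s(2) sq unfolding successively_append_iff by auto
    then show "successively E ?p1" by simp
    show "hd ?p1 = u" using p(1) ac by (cases a) (auto simp: spath_def)
    show "last ?p1 = w" using r q(1) by (cases r1) (auto simp: spath_def)
  qed (use p(1) r q ac in \<open>auto simp: spath_def\<close>)
  moreover have "spath E K w ?p2 z"
    unfolding spath_def
  proof (intro conjI)
    have "successively E (r1 @ (q # c))"
      using s(1,3) unfolding successively_append_iff by auto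
    then show "successively E ?p2" by simp
    show "hd ?p2 = w" using r q(1) by (cases r1) (auto simp: spath_def)
    show "last ?p2 = z" using p(1) ac by (cases c) (auto simp: spath_def)
  qed (use p(1) r q ac in \<open>auto simp: spath_def\<close>)
  moreover have "b \<longleftrightarrow> even (length ?p1) \<noteq> even (length ?p2)"
    using p(2) by (auto simp: ac)
  ultimately show ?thesis unfolding parity_path_def by blast
qed

text \<open>An odd path from \<open>x\<close> to \<open>z\<close> would split at \<open>y\<close>
  into two paths of different parities, one of them odd, which is forbidden. As even paths between
  distinct \<open>x\<close> and \<open>z\<close> are forbidden too, any \<open>y\<close> forces
  \<open>x = z\<close> for all choices. The sets will be the red neighbourhoods of three consecutive
  cycle vertices.\<close>

lemma no_three:
  assumes K: "X \<subseteq> K" "Y \<subseteq> K" "Z \<subseteq> K"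
    and XY: "\<And>x y. x \<in> X \<Longrightarrow> y \<in> Y \<Longrightarrow> \<not> parity_path True x y"
    and YZ: "\<And>y z. y \<in> Y \<Longrightarrow> z \<in> Z \<Longrightarrow> \<not> parity_path True y z"
    and XZ: "\<And>x z. x \<in> X \<Longrightarrow> z \<in> Z \<Longrightarrow> x \<noteq> z \<Longrightarrow> \<not> parity_path False x z"
  shows "\<not> (2 \<le> card X \<and> 2 \<le> card Y \<and> Z \<noteq> {})"
    and "\<not> (2 \<le> card X \<and> Y \<noteq> {} \<and> 2 \<le> card Z)"
    and "\<not> (X \<noteq> {} \<and> 2 \<le> card Y \<and> 2 \<le> card Z)"
proof -
  have other: "\<exists>y \<in> S. y \<noteq> x" if "2 \<le> card S" for S and x :: 'a
  proof (rule ccontr)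
    assume "\<not> ?thesis"
    then have "S \<subseteq> {x}" by blast
    then have "card S \<le> 1" using card_mono[of "{x}" S] by simp
    then show False using that by simp
  qed
  have "x = z" if xyz: "x \<in> X" "y \<in> Y" "z \<in> Z" for x y z
  proof (rule ccontr)
    assume "x \<noteq> z"
    then have "parity_path True x z" using parity_path_ex[of x z] XZ xyz K by (metis (full_types) subsetD)
    then obtain b1 b2 where "parity_path b1 x y" "parity_path b2 y z" "b1 \<noteq> b2" using tripod[of True x z y] xyz K by auto
    then show False using XY YZ xyz by (metis (full_types))
  qed
  then show "\<not> (2 \<le> card X \<and> 2 \<le> card Y \<and> Z \<noteq> {})"
    and "\<not> (2 \<le> card X \<and> Y \<noteq> {} \<and> 2 \<le> card Z)"
    and "\<not> (X \<noteq> {} \<and> 2 \<le> card Y \<and> 2 \<le> card Z)"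
    using other by (metis card.empty equals0I not_numeral_le_zero)+
qed

text \<open>Going through a vertex of \<open>Y\<close> gives an odd path from each \<open>x\<close>
  to each \<open>z\<close>, which must be a single edge by \<open>XZ\<close>. Two vertices on each
  side then give the path \<open>x, z', x', z\<close>, which has the forbidden four
  vertices.\<close>

lemma no_gap_three:
  assumes K: "X \<subseteq> K" "Y \<subseteq> K" "Z \<subseteq> K"
    and XY: "\<And>x y. x \<in> X \<Longrightarrow> y \<in> Y \<Longrightarrow> \<not> parity_path True x y"
    and YZ: "\<And>y z. y \<in> Y \<Longrightarrow> z \<in> Z \<Longrightarrow> y \<noteq> z \<Longrightarrow> \<not> parity_path False y z"
    and XZ: "\<And>x z p. x \<in> X \<Longrightarrow> z \<in> Z \<Longrightarrow> spath E K x p z \<Longrightarrow> even (length p) \<Longrightarrow> length p < 4"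
  shows "\<not> (2 \<le> card X \<and> 2 \<le> card Y \<and> 2 \<le> card Z)"
proof
  assume big: "2 \<le> card X \<and> 2 \<le> card Y \<and> 2 \<le> card Z"
  have two: "\<exists>x \<in> S. \<exists>y \<in> S. x \<noteq> y" if "2 \<le> card S" for S :: "'a set"
    using obtain_subset_with_card_n[OF that] by (metis card_2_iff' subsetD)
  have Y_other: "\<exists>y \<in> Y. y \<noteq> x" for x using two[of Y] big by metis
  have disj: "z \<notin> X" if "z \<in> Z" for z
  proof
    assume "z \<in> X"
    obtain y where y: "y \<in> Y" "y \<noteq> z" using Y_other by blast
    then have "parity_path True y z" using parity_path_ex[of y z] YZ[OF y(1) that] that K by (metis (full_types) subsetD)
    then show False using XY \<open>z \<in> X\<close> y(1) parity_path_sym by blast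
  qed
  have edge: "E x z" if xz: "x \<in> X" "z \<in> Z" for x z
  proof -
    have "x \<noteq> z" using disj xz by blast
    obtain y where y: "y \<in> Y" "y \<noteq> z" using Y_other by blast
    obtain b where b: "parity_path b x z" using parity_path_ex xz K by blast
    obtain b1 b2 where b12: "parity_path b1 x y" "parity_path b2 y z" "b \<longleftrightarrow> b1 \<noteq> b2"
      using tripod[OF b, of y] y K by blast
    have "\<not> b1" using b12(1) XY[OF xz(1) y(1)] by (cases b1) auto
    moreover have b2 using b12(2) YZ[OF y(1) xz(2) y(2)] by (cases b2) auto
    ultimately have "parity_path True x z" using b b12(3) by simp
    then obtain p where p: "spath E K x p z" "even (length p)" unfolding parity_path_def by blast
    then have "length p < 4" using XZ xz by blast
    moreover have "length p \<noteq> 0" using p(1) by (simp add: spath_def)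
    ultimately have "length p = 2" using p(2) by presburger
    then obtain a c where "p = [a, c]" by (metis length_0_conv length_Suc_conv numeral_2_eq_2)
    then show ?thesis using p(1) by (auto simp: spath_def)
  qed
  obtain x x' where x: "x \<in> X" "x' \<in> X" "x \<noteq> x'" using two[of X] big by blast
  obtain z z' where z: "z \<in> Z" "z' \<in> Z" "z \<noteq> z'" using two[of Z] big by blast
  have "x \<noteq> z" "x \<noteq> z'" "x' \<noteq> z" "x' \<noteq> z'" using disj x z by blast+
  then have "spath E K x [x, z', x', z] z"
    using x z edge[OF x(1) z(2)] edge[OF x(2) z(1)] E_sym[OF edge[OF x(2) z(2)]] K
    by (auto simp: spath_def)
  then show False using XZ[OF x(1) z(1)] by fastforce
qed

end

section \<open>Greedy choice of representatives and sums over a period\<close>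

lemma ex_distinct_choice:
  assumes "\<And>i. i < t \<Longrightarrow> finite (A i)" "\<And>i. i < t \<Longrightarrow> t \<le> card (A i)"
  shows "\<exists>xs. length xs = t \<and> distinct xs \<and> (\<forall>i<t. xs ! i \<in> A i)"
proof -
  have "s \<le> t \<Longrightarrow> \<exists>xs. length xs = s \<and> distinct xs \<and> (\<forall>i<s. xs ! i \<in> A i)" for s
  proof (induction s)
    case (Suc s)
    then obtain xs where xs: "length xs = s" "distinct xs" "\<forall>i<s. xs ! i \<in> A i" by auto
    have "card (set xs) < card (A s)" using xs assms(2)[of s] Suc.prems distinct_card[of xs] by simp
    then have "\<not> A s \<subseteq> set xs" using card_mono[of "set xs" "A s"] by auto
    then obtain x where "x \<in> A s" "x \<notin> set xs" by blast
    then have "length (xs @ [x]) = Suc s \<and> distinct (xs @ [x]) \<and> (\<forall>i<Suc s. (xs @ [x]) ! i \<in> A i)"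
      using xs by (auto simp: nth_append less_Suc_eq)
    then show ?case by blast
  qed simp
  then show ?thesis by blast
qed

lemma sum_periodic:
  fixes f :: "nat \<Rightarrow> nat"
  assumes "\<And>i. f (i + L) = f i"
  shows "(\<Sum>i<L. f (i + k)) = (\<Sum>i<L. f i)"
proof (induction k)
  case (Suc k)
  have "(\<Sum>i<L. f (i + Suc k)) + f k = (\<Sum>i<Suc L. f (i + k))"
    by (subst sum.lessThan_Suc_shift) (simp add: add.commute)
  also have "\<dots> = (\<Sum>i<L. f (i + k)) + f k" using assms[of k] by (simp add: add.commute)
  finally show ?case using Suc by simp
qed simp

section \<open>Extending a longest even cycle\<close>

text \<open>A longest even monochromatic cycle \<open>v\<close>, of length \<open>2m\<close> and red, faces a large red-connected set
  \<open>K\<close> of outside vertices.  Paths inside \<open>K\<close> between red neighbours of nearby cycle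
  vertices must have prescribed parities, so at most half of the cycle vertices have two or more
  red neighbours in \<open>K\<close>; the others see \<open>K\<close> almost entirely in blue, which yields
  a blue cycle of length \<open>2m + 2\<close>.\<close>

locale stuck_cycle = blowup V R B n for V :: "'a set" and R B :: "'a \<Rightarrow> 'a \<Rightarrow> bool" and n :: nat +
  fixes m :: nat and v :: "nat \<Rightarrow> 'a" and K :: "'a set"
  assumes m2: "2 \<le> m" and w: "periodic_cycle R (2 * m) v"
    and noR: "m < l \<Longrightarrow> \<not> has_cycle R (2 * l)"
    and noB: "\<not> has_cycle B (2 * (m + 1))"
    and KV: "K \<subseteq> V" and Kv: "K \<inter> range v = {}"
    and K_linked: "x \<in> K \<Longrightarrow> y \<in> K \<Longrightarrow> linked R K x y"
    and adj: "k \<in> K \<Longrightarrow> R k (v i) \<or> B k (v i)"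
    and cardK: "n + 3 \<le> card K" "m + 4 \<le> card K"
begin

sublocale linked_set R K
  by unfold_locales (fact R_sym, fact K_linked)

lemma finK: "finite K"
  using KV finV finite_subset by blast

definition nbrs :: "nat \<Rightarrow> 'a set" where
  "nbrs i = {u \<in> K. R u (v i)}"

lemma nbrs_K: "nbrs i \<subseteq> K"
  by (auto simp: nbrs_def)

lemma fin_nbrs: "finite (nbrs i)"
  using nbrs_K finK finite_subset by blast

lemma nbrs_cong: "v i = v j \<Longrightarrow> nbrs i = nbrs j"
  by (simp add: nbrs_def)

lemma nbrs_periodic: "nbrs (i + 2 * m) = nbrs i"
  using periodic_cycle_add[OF w] by (simp add: nbrs_def)

lemma not_nbr: "k \<in> K \<Longrightarrow> k \<notin> nbrs i \<Longrightarrow> B (v i) k"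
  using adj[of k i] B_sym by (auto simp: nbrs_def)

lemma detour:
  assumes "x \<in> nbrs i" "y \<in> nbrs (i + d)" "spath R K x p y" "1 \<le> d" "d \<le> 2 * m"
  shows "has_cycle R (2 * m - d + 1 + length p)"
  using assms Kv by (intro periodic_cycle_detour[OF w, where i = i]) (auto simp: spath_def nbrs_def R_sym)

text \<open>A path with \<open>2 * t\<close> vertices replacing one cycle edge would give a red
  cycle of length \<open>2 * (m + t)\<close>.\<close>

lemma nbrs_1:
  assumes "x \<in> nbrs i" "y \<in> nbrs (i + 1)"
  shows "\<not> parity_path True x y"
proof
  assume "parity_path True x y"
  then obtain p where p: "spath R K x p y" "even (length p)" by (auto simp: parity_path_def)
  then have "length p \<noteq> 0" by (simp add: spath_def)
  then obtain t where t: "length p = 2 * t" "0 < t" using p(2) by auto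
  have "has_cycle R (2 * m - 1 + 1 + length p)"
    by (rule detour[OF assms p(1)]) (use m2 in simp_all)
  moreover have "2 * m - 1 + 1 + length p = 2 * (m + t)" using m2 t by simp
  ultimately show False using noR[of "m + t"] t(2) by auto
qed

text \<open>Here one cycle vertex is lost, so a path with an odd number of vertices is inserted. A
  single vertex would only be an exchange, which is why \<open>x\<close> and \<open>y\<close> must
  differ.\<close>

lemma nbrs_2:
  assumes "x \<in> nbrs i" "y \<in> nbrs (i + 2)" "x \<noteq> y"
  shows "\<not> parity_path False x y"
proof
  assume "parity_path False x y"
  then obtain p where p: "spath R K x p y" "odd (length p)" by (auto simp: parity_path_def)
  have "length p \<noteq> 1"
    using p assms(3) by (auto simp: spath_def length_Suc_conv)
  moreover obtain t where t: "length p = 2 * t + 1" using p(2) oddE by blast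
  ultimately have "0 < t" by (cases t) auto
  have "has_cycle R (2 * m - 2 + 1 + length p)"
    by (rule detour[OF assms(1,2) p(1)]) (use m2 in simp_all)
  moreover have "2 * m - 2 + 1 + length p = 2 * (m + t)" using m2 t by simp
  ultimately show False using noR[of "m + t"] \<open>0 < t\<close> by auto
qed

text \<open>Two cycle vertices are lost; a path with two vertices merely restores the length, but
  four or more would increase it.\<close>

lemma nbrs_3:
  assumes "x \<in> nbrs i" "y \<in> nbrs (i + 3)" "spath R K x p y" "even (length p)"
  shows "length p < 4"
proof (rule ccontr)
  assume "\<not> length p < 4"
  moreover obtain t where t: "length p = 2 * t" using assms(4) by blast
  ultimately have t: "2 * m - 3 + 1 + length p = 2 * (m + (t - 1))" "0 < t - 1" using m2 by simp_all
  have "has_cycle R (2 * m - 3 + 1 + length p)"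
    by (rule detour[OF assms(1,2,3)]) (use m2 in simp_all)
  then show False using noR[of "m + (t - 1)"] t by auto
qed

text \<open>Two is the threshold needed by the parity lemmas; below it, all but at most one vertex
  of \<open>K\<close> is joined to \<open>v i\<close> in blue.\<close>

definition bad :: "nat \<Rightarrow> bool" where
  "bad i \<longleftrightarrow> 2 \<le> card (nbrs i)"

lemma bad_nonempty: "bad i \<Longrightarrow> nbrs i \<noteq> {}"
  by (auto simp: bad_def)

lemma three:
  shows "bad i \<Longrightarrow> bad (i + 1) \<Longrightarrow> nbrs (i + 2) = {}"
    and "bad i \<Longrightarrow> bad (i + 2) \<Longrightarrow> nbrs (i + 1) = {}"
    and "bad (i + 1) \<Longrightarrow> bad (i + 2) \<Longrightarrow> nbrs i = {}"
proof -
  have *: "\<not> parity_path True y z" if "y \<in> nbrs (i + 1)" "z \<in> nbrs (i + 2)" for y z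
    using nbrs_1[of y "i + 1" z] that by simp
  have "\<not> (2 \<le> card (nbrs i) \<and> 2 \<le> card (nbrs (i + 1)) \<and> nbrs (i + 2) \<noteq> {})"
    by (rule no_three(1)) (fact nbrs_K, fact nbrs_K, fact nbrs_K, erule (1) nbrs_1, erule (1) *, erule (2) nbrs_2)
  moreover have "\<not> (2 \<le> card (nbrs i) \<and> nbrs (i + 1) \<noteq> {} \<and> 2 \<le> card (nbrs (i + 2)))"
    by (rule no_three(2)) (fact nbrs_K, fact nbrs_K, fact nbrs_K, erule (1) nbrs_1, erule (1) *, erule (2) nbrs_2)
  moreover have "\<not> (nbrs i \<noteq> {} \<and> 2 \<le> card (nbrs (i + 1)) \<and> 2 \<le> card (nbrs (i + 2)))"
    by (rule no_three(3)) (fact nbrs_K, fact nbrs_K, fact nbrs_K, erule (1) nbrs_1, erule (1) *, erule (2) nbrs_2)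
  ultimately show "bad i \<Longrightarrow> bad (i + 1) \<Longrightarrow> nbrs (i + 2) = {}"
    and "bad i \<Longrightarrow> bad (i + 2) \<Longrightarrow> nbrs (i + 1) = {}"
    and "bad (i + 1) \<Longrightarrow> bad (i + 2) \<Longrightarrow> nbrs i = {}"
    unfolding bad_def by blast+
qed

lemma not_bad_0_1_3: "\<not> (bad i \<and> bad (i + 1) \<and> bad (i + 3))"
proof -
  have *: "\<not> parity_path False y z" if "y \<in> nbrs (i + 1)" "z \<in> nbrs (i + 3)" "y \<noteq> z" for y z
    using nbrs_2[of y "i + 1" z] that by (simp add: numeral_eq_Suc)
  show ?thesis
    unfolding bad_def
    by (rule no_gap_three) (fact nbrs_K, fact nbrs_K, fact nbrs_K, erule (1) nbrs_1, erule (2) *, erule (3) nbrs_3)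
qed

lemma not_bad_0_2_3: "\<not> (bad i \<and> bad (i + 2) \<and> bad (i + 3))"
proof -
  have 1: "\<not> parity_path True x y" if "x \<in> nbrs (i + 3)" "y \<in> nbrs (i + 2)" for x y
    using nbrs_1[of y "i + 2" x] that parity_path_sym by (auto simp: numeral_eq_Suc)
  have 2: "\<not> parity_path False y z" if "y \<in> nbrs (i + 2)" "z \<in> nbrs i" "y \<noteq> z" for y z
    using nbrs_2[of z i y] that parity_path_sym by blast
  have 3: "length p < 4" if "x \<in> nbrs (i + 3)" "z \<in> nbrs i" "spath R K x p z" "even (length p)" for x z p
    using nbrs_3[of z i x "rev p"] that spath_rev by simp
  have "\<not> (2 \<le> card (nbrs (i + 3)) \<and> 2 \<le> card (nbrs (i + 2)) \<and> 2 \<le> card (nbrs i))"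
    by (rule no_gap_three) (fact nbrs_K, fact nbrs_K, fact nbrs_K, erule (1) 1, erule (2) 2, erule (3) 3)
  then show ?thesis unfolding bad_def by blast
qed

section \<open>Counting bad positions in windows of four\<close>

definition bad_ind :: "nat \<Rightarrow> nat" where
  "bad_ind i = of_bool (bad i)"

text \<open>Each of the four ways to have three bad positions among four consecutive ones is
  excluded.\<close>

lemma window: "bad_ind i + bad_ind (i + 1) + bad_ind (i + 2) + bad_ind (i + 3) \<le> 2"
proof -
  have "\<not> (bad i \<and> bad (i + 1) \<and> bad (i + 2))" using three(1)[of i] bad_nonempty by blast
  moreover have "\<not> (bad (i + 1) \<and> bad (i + 2) \<and> bad (i + 3))"
    using three(1)[of "i + 1"] bad_nonempty[of "i + 3"] by (auto simp: numeral_eq_Suc)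
  ultimately show ?thesis
    using not_bad_0_1_3[of i] not_bad_0_2_3[of i] by (auto simp: bad_ind_def of_bool_def)
qed

lemma bad_ind_periodic: "bad_ind (i + 2 * m) = bad_ind i"
  by (simp add: bad_ind_def bad_def nbrs_periodic)

lemma sum_windows:
  "(\<Sum>i<2 * m. bad_ind i + bad_ind (i + 1) + bad_ind (i + 2) + bad_ind (i + 3)) = 4 * (\<Sum>i<2 * m. bad_ind i)"
  unfolding sum.distrib
  using sum_periodic[of bad_ind "2 * m" 1, OF bad_ind_periodic] sum_periodic[of bad_ind "2 * m" 2, OF bad_ind_periodic]
    sum_periodic[of bad_ind "2 * m" 3, OF bad_ind_periodic]
  by simp

text \<open>Every position is counted by four windows, and each window contains at most two bad
  positions.\<close>

lemma sum_bad_ind: "(\<Sum>i<2 * m. bad_ind i) \<le> m"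
proof -
  have "(\<Sum>i<2 * m. bad_ind i + bad_ind (i + 1) + bad_ind (i + 2) + bad_ind (i + 3)) \<le> (\<Sum>i<2 * m. 2)"
    by (rule sum_mono) (rule window)
  then show ?thesis unfolding sum_windows by simp
qed

section \<open>Blue cycles through the good vertices\<close>

definition good :: "'a set" where
  "good = v ` {i. i < 2 * m \<and> \<not> bad i}"

lemma good_range: "good \<subseteq> range v"
  by (auto simp: good_def)

lemma card_good: "card good + (\<Sum>i<2 * m. bad_ind i) = 2 * m"
proof -
  have "card good = card {i. i < 2 * m \<and> \<not> bad i}"
    unfolding good_def by (rule card_image, rule inj_on_subset[OF periodic_cycle_inj[OF w, of 0]]) auto
  moreover have "(\<Sum>i<2 * m. bad_ind i) = card {i. i < 2 * m \<and> bad i}"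
    unfolding bad_ind_def by (simp add: of_bool_def sum.If_cases) (rule arg_cong[of _ _ card], auto)
  moreover have "card ({i. i < 2 * m \<and> \<not> bad i} \<union> {i. i < 2 * m \<and> bad i}) = 2 * m"
    by (rule trans[OF arg_cong[of _ "{..<2*m}" card]]) auto
  moreover have "card ({i. i < 2 * m \<and> \<not> bad i} \<union> {i. i < 2 * m \<and> bad i}) =
      card {i. i < 2 * m \<and> \<not> bad i} + card {i. i < 2 * m \<and> bad i}"
    by (rule card_Un_disjoint) auto
  ultimately show ?thesis by simp
qed

lemma good_missing:
  assumes "g \<in> good"
  shows "card {u \<in> K. \<not> B g u} \<le> 1"
proof -
  obtain i where i: "g = v i" "\<not> bad i" using assms by (auto simp: good_def)
  have "{u \<in> K. \<not> B g u} \<subseteq> nbrs i" using not_nbr i(1) by blast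
  then have "card {u \<in> K. \<not> B g u} \<le> card (nbrs i)" by (rule card_mono[OF fin_nbrs])
  then show ?thesis using i(2) unfolding bad_def by linarith
qed

text \<open>Arrange \<open>m + 1\<close> good vertices cyclically. Consecutive ones have all but at
  most two vertices of \<open>K\<close> as common blue neighbours, at least \<open>m + 2\<close> of
  them, so distinct ones can be inserted to form a blue cycle of length \<open>2 * (m + 1)\<close>.
  The opposite inequality is \<open>sum_bad_ind\<close>.\<close>

lemma card_good_eq: "card good = m"
proof (rule ccontr)
  assume "card good \<noteq> m"
  then have "m + 1 \<le> card good" using card_good sum_bad_ind by linarith
  then obtain gs where gs: "distinct gs" "length gs = m + 1" "set gs \<subseteq> good"
    using ex_distinct_list by blast
  define next_g where "next_g i = gs ! (Suc i mod (m + 1))" for i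
  define A where "A i = {u \<in> K. B (gs ! i) u \<and> B (next_g i) u}" for i
  have gm: "gs ! i \<in> good" "next_g i \<in> good" if "i < m + 1" for i
    using gs that unfolding next_g_def by (auto intro!: subsetD[OF gs(3)] nth_mem)
  have "m + 1 \<le> card (A i)" if "i < m + 1" for i
  proof -
    have "K \<subseteq> A i \<union> ({u \<in> K. \<not> B (gs ! i) u} \<union> {u \<in> K. \<not> B (next_g i) u})"
      by (auto simp: A_def)
    then have "card K \<le> card (A i \<union> ({u \<in> K. \<not> B (gs ! i) u} \<union> {u \<in> K. \<not> B (next_g i) u}))"
      using finK by (intro card_mono) (auto simp: A_def)
    also have "\<dots> \<le> card (A i) + card ({u \<in> K. \<not> B (gs ! i) u} \<union> {u \<in> K. \<not> B (next_g i) u})"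
      by (rule card_Un_le)
    also have "\<dots> \<le> card (A i) + (card {u \<in> K. \<not> B (gs ! i) u} + card {u \<in> K. \<not> B (next_g i) u})"
      by (intro add_left_mono card_Un_le)
    finally show ?thesis using good_missing[OF gm(1)[OF that]] good_missing[OF gm(2)[OF that]] cardK(2) by linarith
  qed
  moreover have "finite (A i)" for i using finK by (auto simp: A_def)
  ultimately obtain ks where ks: "length ks = m + 1" "distinct ks" "\<forall>i<m + 1. ks ! i \<in> A i"
    using ex_distinct_choice[of "m + 1" A] by blast
  have "set ks \<subseteq> K" using ks by (auto simp: A_def in_set_conv_nth)
  then have "set gs \<inter> set ks = {}" using gs(3) good_range Kv by blast
  then have "has_cycle B (2 * (m + 1))"
  proof (intro has_cycle_zigzag[of gs "m + 1" ks])
    have *: "B (gs ! i) (ks ! i)" "B (ks ! i) (gs ! (Suc i mod (m + 1)))" if "i < m + 1" for i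
      using ks(3) that B_sym by (auto simp: A_def next_g_def)
    show "B (gs ! i) (ks ! i)" if "i < m + 1" for i using *(1) that .
    show "B (ks ! i) (gs ! Suc i)" if "Suc i < m + 1" for i using *(2)[of i] that by simp
    show "B (ks ! (m + 1 - 1)) (gs ! 0)" using *(2)[of m] by simp
  qed (use ks gs \<open>set gs \<inter> set ks = {}\<close> in simp_all)
  then show False using noB by blast
qed

text \<open>With exactly \<open>m\<close> bad positions, the averaging over windows is an equality,
  so no window may fall below its maximum.\<close>

lemma window_eq: "bad_ind i + bad_ind (i + 1) + bad_ind (i + 2) + bad_ind (i + 3) = 2"
proof -
  let ?W = "\<lambda>i. bad_ind i + bad_ind (i + 1) + bad_ind (i + 2) + bad_ind (i + 3)"
  have "(\<Sum>i<2 * m. bad_ind i) = m" using card_good card_good_eq by simp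
  then have "(\<Sum>i<2 * m. ?W i) = 2 * (2 * m)" unfolding sum_windows by simp
  then have s: "(\<Sum>i<2 * m. ?W i) = (\<Sum>i<2 * m. 2)" by simp
  have *: "?W i = 2" if "i < 2 * m" for i
    using sum_mono_inv[OF s window, of i] that by simp
  have per: "bad_ind (i mod (2 * m) + k) = bad_ind (i + k)" for k
  proof -
    have "v (i mod (2 * m) + k) = v (i + k)" using w by (simp add: periodic_cycle_def mod_add_left_eq)
    then show ?thesis using nbrs_cong unfolding bad_ind_def bad_def by metis
  qed
  show ?thesis using *[of "i mod (2 * m)"] per[of 0] per[of 1] per[of 2] per[of 3] m2 by simp
qed

text \<open>As every window has exactly two bad positions, position \<open>i\<close> lies between
  two bad ones, or is followed or preceded by two consecutive bad ones. Each pattern rules out even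
  a single red neighbour.\<close>

lemma good_empty:
  assumes "\<not> bad i"
  shows "nbrs i = {}"
proof -
  \<comment> \<open>This is position \<open>i - 2\<close> modulo the length of the cycle.\<close>
  define j where "j = i + (2 * m - 2)"
  have "j + 2 = i + 2 * m" using m2 by (simp add: j_def)
  then have j: "v (j + 2) = v i" using periodic_cycle_add[OF w, of i] by simp
  have nb: "\<not> bad (j + 2)" using assms nbrs_cong[OF j] by (simp add: bad_def)
  have "nbrs (j + 2) = {}"
  proof (cases "bad (j + 3)")
    case True
    show ?thesis
    proof (cases "bad (j + 1)")
      case True
      then show ?thesis using three(2)[of "j + 1"] \<open>bad (j + 3)\<close> by (simp add: numeral_eq_Suc)
    next
      case False
      then have "bad (j + 4)" using window_eq[of "j + 1"] nb \<open>bad (j + 3)\<close>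
        by (auto simp: bad_ind_def of_bool_def numeral_eq_Suc split: if_splits)
      then show ?thesis using three(3)[of "j + 2"] \<open>bad (j + 3)\<close> by (simp add: numeral_eq_Suc)
    qed
  next
    case False
    then have "bad j" "bad (j + 1)" using window_eq[of j] nb
      by (auto simp: bad_ind_def of_bool_def split: if_splits)
    then show ?thesis using three(1) by blast
  qed
  then show ?thesis using nbrs_cong[OF j] by simp
qed

lemma good_full:
  assumes "g \<in> good" "k \<in> K"
  shows "B g k"
proof -
  obtain i where "g = v i" "\<not> bad i" using assms(1) by (auto simp: good_def)
  then show ?thesis using not_nbr[OF assms(2)] good_empty by blast
qed

text \<open>The vertex \<open>e\<close> acts as one more good vertex: a blue cycle of length
  \<open>2 * (m + 1)\<close> alternates between \<open>e\<close> with the good vertices and vertices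
  of \<open>K\<close>, where \<open>k\<close> and \<open>k'\<close> are the neighbours of
  \<open>e\<close>. Since \<open>e\<close> may lie in \<open>K\<close> itself, it is kept apart from
  \<open>k\<close> and \<open>k'\<close>.\<close>

lemma no_extra:
  assumes e: "e \<notin> good" and k: "k \<in> K" "k' \<in> K" "k \<noteq> k'" "e \<noteq> k" "e \<noteq> k'"
    and B: "B e k" "B e k'"
  shows False
proof -
  obtain gs where gs: "distinct gs" "length gs = m" "set gs \<subseteq> good"
    using ex_distinct_list[of m good] card_good_eq by auto
  have "m - 1 \<le> card K - card {e, k, k'}" using cardK(2) card_insert_le_m1[of 3 "{k, k'}" e] k by simp
  also have "\<dots> \<le> card (K - {e, k, k'})" by (rule diff_card_le_card_Diff) simp
  finally obtain rs where rs: "distinct rs" "length rs = m - 1" "set rs \<subseteq> K - {e, k, k'}"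
    using ex_distinct_list by blast
  let ?as = "e # gs" and ?bs = "k # rs @ [k']"
  have bK: "?bs ! i \<in> K" if "i < m + 1" for i
  proof -
    have "set ?bs \<subseteq> K" using rs k by auto
    moreover have "i < length ?bs" using that rs m2 by simp
    ultimately show ?thesis using nth_mem by blast
  qed
  have gg: "gs ! i \<in> good" if "i < m" for i using gs that nth_mem by blast
  have "has_cycle B (2 * (m + 1))"
  proof (rule has_cycle_zigzag[of ?as "m + 1" ?bs])
    have "set gs \<inter> K = {}" using gs(3) good_range Kv by blast
    then show "distinct (?as @ ?bs)" using gs rs k e by auto
    show "length ?as = m + 1" "length ?bs = m + 1" "1 \<le> m + 1" using gs rs m2 by simp_all
    fix i assume i: "i < m + 1"
    show "B (?as ! i) (?bs ! i)"
    proof (cases i)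
      case (Suc j)
      then show ?thesis using good_full[OF gg bK[OF i]] i by simp
    qed (use B in simp)
  next
    fix i assume "Suc i < m + 1"
    then show "B (?bs ! i) (?as ! Suc i)" using B_sym[OF good_full[OF gg bK]] by simp
  next
    have "?bs ! (m + 1 - 1) = k'" using rs(2) m2 by (simp add: nth_append)
    then show "B (?bs ! (m + 1 - 1)) (?as ! 0)" using B B_sym by simp
  qed
  then show False using noB by blast
qed

lemma card_bad:
  assumes "bad i"
  shows "card (K - nbrs i) \<le> 1"
proof (rule ccontr)
  assume "\<not> ?thesis"
  then obtain k k' where kk: "k \<in> K - nbrs i" "k' \<in> K - nbrs i" "k \<noteq> k'"
    using obtain_subset_with_card_n[of 2 "K - nbrs i"] by (metis card_2_iff' not_less_eq_eq numeral_2_eq_2 One_nat_def subsetD)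
  have "v i \<notin> good"
  proof
    assume "v i \<in> good"
    then obtain j where "v i = v j" "\<not> bad j" by (auto simp: good_def)
    then show False using assms nbrs_cong[of i j] by (simp add: bad_def)
  qed
  moreover have "v i \<notin> K" using Kv by blast
  ultimately show False using no_extra[of "v i" k k'] kk not_nbr by blast
qed

lemma card_common:
  assumes "bad i" "bad j"
  shows "n + 1 \<le> card (nbrs i \<inter> nbrs j)"
proof -
  have "K \<subseteq> (nbrs i \<inter> nbrs j) \<union> ((K - nbrs i) \<union> (K - nbrs j))" by blast
  then have "card K \<le> card ((nbrs i \<inter> nbrs j) \<union> ((K - nbrs i) \<union> (K - nbrs j)))"
    using finK fin_nbrs by (intro card_mono) auto
  also have "\<dots> \<le> card (nbrs i \<inter> nbrs j) + card ((K - nbrs i) \<union> (K - nbrs j))" by (rule card_Un_le)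
  also have "\<dots> \<le> card (nbrs i \<inter> nbrs j) + (card (K - nbrs i) + card (K - nbrs j))"
    by (intro add_left_mono card_Un_le)
  finally show ?thesis using card_bad[OF assms(1)] card_bad[OF assms(2)] cardK(1) by linarith
qed

text \<open>Among three common red neighbours of \<open>v i\<close> and \<open>v (i + 2)\<close> all
  connecting paths are odd, yet an odd path from \<open>x\<close> to \<open>z\<close> splits at
  \<open>y\<close> into an odd and an even one.\<close>

lemma not_bad_0_2: "\<not> (bad i \<and> bad (i + 2))"
proof
  assume "bad i \<and> bad (i + 2)"
  then have "3 \<le> card (nbrs i \<inter> nbrs (i + 2))" using card_common n3 by fastforce
  then obtain S where "S \<subseteq> nbrs i \<inter> nbrs (i + 2)" "card S = 3" by (rule obtain_subset_with_card_n)
  then obtain x y z where xyz: "x \<in> nbrs i \<inter> nbrs (i + 2)" "y \<in> nbrs i \<inter> nbrs (i + 2)"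
      "z \<in> nbrs i \<inter> nbrs (i + 2)" "x \<noteq> y" "y \<noteq> z" "x \<noteq> z"
    unfolding card_3_iff by blast
  then have K: "x \<in> K" "y \<in> K" "z \<in> K" using nbrs_K by blast+
  have no: "\<not> parity_path False x y" "\<not> parity_path False y z" "\<not> parity_path False x z" using nbrs_2[of _ i] xyz by auto
  have "parity_path True x z" using parity_path_ex[OF K(1,3)] no by (metis (full_types))
  then obtain b1 b2 where "parity_path b1 x y" "parity_path b2 y z" "b1 \<noteq> b2" using tripod[OF _ K(2)] by blast
  then show False using no by (metis (full_types))
qed

text \<open>Common red neighbours of consecutive cycle vertices are pairwise not red-adjacent, since
  an edge is an odd path. There are at least \<open>n + 1\<close> of them and a part has at most
  \<open>n - 1\<close> vertices, so one of them has two blue neighbours among the others and serves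
  as \<open>e\<close> in \<open>no_extra\<close>.\<close>

lemma not_bad_0_1: "\<not> (bad i \<and> bad (i + 1))"
proof
  assume "bad i \<and> bad (i + 1)"
  then have c: "n + 1 \<le> card (nbrs i \<inter> nbrs (i + 1))" using card_common by blast
  let ?S = "nbrs i \<inter> nbrs (i + 1)"
  have noR: "\<not> R x y" if "x \<in> ?S" "y \<in> ?S" for x y
  proof (cases "x = y")
    case False
    then show ?thesis using nbrs_1[of x i y] parity_path_edge[of x y] that nbrs_K by blast
  qed (use R_irrefl in blast)
  obtain x where x: "x \<in> ?S" using c by (metis all_not_in_conv card.empty not_one_le_zero add_leE)
  let ?N = "{u \<in> V. \<not> R x u \<and> \<not> B x u}"
  have xV: "x \<in> V" using x nbrs_K KV by blast
  have "card ?S - card ?N \<le> card (?S - ?N)" using finV by (intro diff_card_le_card_Diff) simp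
  then have "2 \<le> card (?S - ?N)" using small[OF xV] c by linarith
  then obtain T where "T \<subseteq> ?S - ?N" "card T = 2" by (rule obtain_subset_with_card_n)
  then obtain y z where yz: "y \<in> ?S - ?N" "z \<in> ?S - ?N" "y \<noteq> z"
    unfolding card_2_iff by blast
  have S: "y \<in> ?S" "z \<in> ?S" "y \<in> V" "z \<in> V" using yz nbrs_K KV by blast+
  then have "B x y" "B x z" using yz noR[OF x S(1)] noR[OF x S(2)] by blast+
  moreover have "x \<notin> good" using x nbrs_K Kv good_range by blast
  moreover have "x \<noteq> y" "x \<noteq> z" using calculation(1,2) B_irrefl by blast+
  ultimately show False using no_extra[of x y z] S yz(3) nbrs_K by blast
qed

text \<open>Two bad positions among four, at distance neither 1 nor 2, must be the outer ones, here
  0 and 3. The next window then needs 4 as well, next to 3.\<close>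

lemma contradiction: False
proof -
  have 1: "bad_ind i + bad_ind (i + 1) \<le> 1" for i using not_bad_0_1[of i] by (auto simp: bad_ind_def)
  have 2: "bad_ind i + bad_ind (i + 2) \<le> 1" for i using not_bad_0_2[of i] by (auto simp: bad_ind_def)
  have "bad_ind 0 + bad_ind 1 + bad_ind 2 + bad_ind 3 = 2" "bad_ind 1 + bad_ind 2 + bad_ind 3 + bad_ind 4 = 2"
    using window_eq[of 0] window_eq[of 1] by (simp_all add: numeral_eq_Suc)
  moreover have "bad_ind 0 + bad_ind 1 \<le> 1" "bad_ind 1 + bad_ind 2 \<le> 1" "bad_ind 2 + bad_ind 3 \<le> 1" "bad_ind 3 + bad_ind 4 \<le> 1"
    using 1[of 0] 1[of 1] 1[of 2] 1[of 3] by (simp_all add: numeral_eq_Suc)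
  moreover have "bad_ind 0 + bad_ind 2 \<le> 1" "bad_ind 1 + bad_ind 3 \<le> 1"
    using 2[of 0] 2[of 1] by (simp_all add: numeral_eq_Suc)
  moreover have "bad_ind i = 0 \<or> bad_ind i = 1" for i by (simp add: bad_ind_def)
  from this[of 0] this[of 1] this[of 2] this[of 3] have
    "bad_ind 0 + bad_ind 1 + bad_ind 2 + bad_ind 3 = 2 \<Longrightarrow> bad_ind 0 + bad_ind 1 \<le> 1 \<Longrightarrow> bad_ind 1 + bad_ind 2 \<le> 1 \<Longrightarrow> bad_ind 2 + bad_ind 3 \<le> 1 \<Longrightarrow>
      bad_ind 0 + bad_ind 2 \<le> 1 \<Longrightarrow> bad_ind 1 + bad_ind 3 \<le> 1 \<Longrightarrow> bad_ind 1 = 0 \<and> bad_ind 2 = 0 \<and> bad_ind 3 = 1"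
    by (elim disjE) simp_all
  ultimately show False by linarith
qed

end

section \<open>The Ramsey bound for blow-ups\<close>

context blowup
begin

lemma not_longest:
  assumes N: "4 * n \<le> card V" and m: "2 \<le> m" "m < n" and C: "has_cycle R (2 * m)"
    and longest: "\<And>l. m < l \<Longrightarrow> \<not> has_cycle R (2 * l) \<and> \<not> has_cycle B (2 * l)"
  shows False
proof -
  obtain v where w: "periodic_cycle R (2 * m) v" using C has_cycle_winds by blast
  let ?C = "range v" and ?E = "\<lambda>x y. \<not> B x y"
  define W where "W = V - ?C"
  have CV: "?C \<subseteq> V" using periodic_cycle_in[OF w] by blast
  have "card W = card V - 2 * m"
    unfolding W_def using CV periodic_cycle_card[OF w] finV by (simp add: card_Diff_subset finite_subset)
  then have cW: "2 * n + 2 \<le> card W" using N m by linarith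
  have WV: "W \<subseteq> V" and finW: "finite W" using finV by (auto simp: W_def)
  \<comment> \<open>If every component of the non-blue relation missed at least \<open>n\<close>
    vertices, there would be a blue cycle of length \<open>2 * n\<close>.\<close>
  have "\<exists>u \<in> W. card {x \<in> W. \<not> linked ?E W u x} < n"
  proof (rule ccontr)
    assume "\<not> ?thesis"
    then have "has_cycle B (2 * n)"
      using cW n3 B_sym by (intro has_cycle_components[OF finW, of n ?E B]) force+
    then show False using longest m by blast
  qed
  then obtain u where u: "u \<in> W" "card {x \<in> W. \<not> linked ?E W u x} < n" by blast
  define K where "K = {x \<in> W. linked ?E W u x}"
  have "card W = card (K \<union> {x \<in> W. \<not> linked ?E W u x})"
    by (rule arg_cong[of _ _ card]) (auto simp: K_def)
  also have "\<dots> \<le> card K + card {x \<in> W. \<not> linked ?E W u x}" by (rule card_Un_le)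
  finally have cK: "n + 3 \<le> card K" using u(2) cW by linarith
  have KV: "K \<subseteq> V" and KC: "K \<inter> ?C = {}" by (auto simp: K_def W_def)
  have lk: "linked R K x y" if "x \<in> K" "y \<in> K" for x y
    using component_linked[OF WV u(1) K_def _ that] cK by simp
  \<comment> \<open>A non-adjacent \<open>k\<close> would be a twin of \<open>v i\<close>. With a
    red neighbour \<open>q\<close> of \<open>k\<close> in \<open>K\<close>, the detour
    \<open>v i, q, k, v (i + 1)\<close> would lengthen the cycle by two.\<close>
  have adj: "R k (v i) \<or> B k (v i)" if k: "k \<in> K" for k i
  proof (rule ccontr)
    assume no: "\<not> ?thesis"
    have "\<not> K \<subseteq> {k}" using card_mono[of "{k}" K] cK by auto
    then obtain y where y: "y \<in> K" "y \<notin> {k}" by blast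
    obtain q where q: "q \<in> K" "q \<noteq> k" "R k q"
      using linked_exit[OF lk[OF k y(1)] singletonI y(2)] by blast
    have vi: "v i \<in> V" using CV by blast
    have "R (v i) q" using R_twin[of k "v i" q] no q k KV vi by blast
    moreover have "R k (v (i + 1))"
      using R_twin[OF subsetD[OF KV k] vi] no periodic_cycle_step[OF w, of i] by simp
    ultimately have "has_cycle R (2 * m - 1 + 1 + length [q, k])"
      using q k KC R_sym m by (intro periodic_cycle_detour[OF w, of _ i 1]) auto
    moreover have "2 * m - 1 + 1 + length [q, k] = 2 * (m + 1)" using m by simp
    ultimately show False using longest[of "m + 1"] by auto
  qed
  have "stuck_cycle V R B n m v K"
  proof
    show "\<not> has_cycle B (2 * (m + 1))" using longest[of "m + 1"] by simp
    show "m + 4 \<le> card K" using cK m by linarith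
  qed (use m w longest KV KC lk adj cK in blast)+
  then show False by (rule stuck_cycle.contradiction)
qed

text \<open>Unless some vertex shares two red neighbours with \<open>u\<close>, each vertex has at
  most one red neighbour among those of \<open>u\<close>. For two of these, \<open>a\<close> and
  \<open>c\<close>, at least \<open>6 - 2 - 1 - 1 = 2\<close> others are then blue to both.\<close>

lemma four_cycle_nbrs:
  assumes complete: "\<And>x y. x \<in> V \<Longrightarrow> y \<in> V \<Longrightarrow> x \<noteq> y \<Longrightarrow> R x y \<or> B x y"
    and u: "u \<in> V" and S: "6 \<le> card {s \<in> V. R u s}"
  shows "has_cycle R (2 * 2) \<or> has_cycle B (2 * 2)"
proof (cases "\<exists>x \<in> V. x \<noteq> u \<and> 2 \<le> card {s \<in> V. R u s \<and> R x s}")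
  case True
  then obtain x where x: "x \<in> V" "x \<noteq> u" "2 \<le> card {s \<in> V. R u s \<and> R x s}" by blast
  have "has_cycle R (2 * 2)"
    by (rule has_cycle_bipartite[of "{u, x}", OF _ _ x(3)]) (use x R_irrefl R_sym in auto)
  then show ?thesis ..
next
  case False
  let ?S = "{s \<in> V. R u s}"
  have fS: "finite ?S" using finV by simp
  have "2 \<le> card ?S" using S by simp
  then obtain T where "T \<subseteq> ?S" "card T = 2" by (rule obtain_subset_with_card_n)
  then obtain a c where ac: "a \<in> ?S" "c \<in> ?S" "a \<noteq> c" unfolding card_2_iff by blast
  let ?Q = "\<lambda>x. {s \<in> V. R u s \<and> R x s}"
  have Q: "card (?Q a) \<le> 1" "card (?Q c) \<le> 1" using False ac R_irrefl by fastforce+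
  define D where "D = ?S - ({a, c} \<union> (?Q a \<union> ?Q c))"
  have "card ({a, c} \<union> (?Q a \<union> ?Q c)) \<le> card {a, c} + (card (?Q a) + card (?Q c))"
    by (meson add_left_mono card_Un_le order_trans)
  moreover have "card ?S - card ({a, c} \<union> (?Q a \<union> ?Q c)) \<le> card D"
    unfolding D_def using finV by (intro diff_card_le_card_Diff) auto
  moreover have "card {a, c} = 2" using ac(3) by simp
  ultimately have D: "2 \<le> card D" using S Q by linarith
  have "has_cycle B (2 * 2)"
  proof (rule has_cycle_bipartite[of "{a, c}", OF _ _ D])
    fix x y assume "x \<in> {a, c}" "y \<in> D"
    then show "B x y \<and> B y x" using complete[of x y] ac B_sym by (auto simp: D_def)
  qed (use ac in \<open>auto simp: D_def\<close>)
  then show ?thesis ..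
qed

text \<open>This makes the longest even cycle exist. Two twins share all their neighbours, two of
  which have the same colour; without twins the colouring is complete and a vertex has six
  neighbours in one colour.\<close>

lemma four_cycle:
  assumes N: "4 * n \<le> card V"
  shows "has_cycle R (2 * 2) \<or> has_cycle B (2 * 2)"
proof (cases "\<exists>u \<in> V. \<exists>x \<in> V. u \<noteq> x \<and> \<not> R u x \<and> \<not> B u x")
  case True
  then obtain u x where ux: "u \<in> V" "x \<in> V" "u \<noteq> x" "\<not> R u x" "\<not> B u x" by blast
  have "V = ({s \<in> V. R u s} \<union> {s \<in> V. B u s}) \<union> {s \<in> V. \<not> R u s \<and> \<not> B u s}" by blast
  then have "card V \<le> card ({s \<in> V. R u s} \<union> {s \<in> V. B u s}) + card {s \<in> V. \<not> R u s \<and> \<not> B u s}"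
    using card_Un_le by metis
  moreover have "card ({s \<in> V. R u s} \<union> {s \<in> V. B u s}) \<le> card {s \<in> V. R u s} + card {s \<in> V. B u s}"
    by (rule card_Un_le)
  ultimately have "2 \<le> card {s \<in> V. R u s} \<or> 2 \<le> card {s \<in> V. B u s}"
    using small[OF ux(1)] N n3 by linarith
  then show ?thesis
  proof
    assume c: "2 \<le> card {s \<in> V. R u s}"
    have "has_cycle R (2 * 2)"
      by (rule has_cycle_bipartite[of "{u, x}", OF _ _ c])
        (use ux R_irrefl R_sym R_twin[OF ux(1,2,4,5)] in auto)
    then show ?thesis ..
  next
    assume c: "2 \<le> card {s \<in> V. B u s}"
    have "has_cycle B (2 * 2)"
      by (rule has_cycle_bipartite[of "{u, x}", OF _ _ c])
        (use ux B_irrefl B_sym B_twin[OF ux(1,2,4,5)] in auto)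
    then show ?thesis ..
  qed
next
  case False
  then have complete: "R x y \<or> B x y" if "x \<in> V" "y \<in> V" "x \<noteq> y" for x y using that by blast
  have "V \<noteq> {}" using N n3 by auto
  then obtain u where u: "u \<in> V" by blast
  have "V = ({s \<in> V. R u s} \<union> {s \<in> V. B u s}) \<union> {u}" using u complete by blast
  then have "card V \<le> card ({s \<in> V. R u s} \<union> {s \<in> V. B u s}) + card {u}"
    using card_Un_le by metis
  moreover have "card ({s \<in> V. R u s} \<union> {s \<in> V. B u s}) \<le> card {s \<in> V. R u s} + card {s \<in> V. B u s}"
    by (rule card_Un_le)
  moreover have "card {u} = 1" by simp
  ultimately have "6 \<le> card {s \<in> V. R u s} \<or> 6 \<le> card {s \<in> V. B u s}"
    using N n3 by linarith
  then show ?thesis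
    using four_cycle_nbrs[OF complete u] blowup.four_cycle_nbrs[OF swap _ u] complete by blast
qed

text \<open>By \<open>descent\<close>, a half-length above \<open>n\<close> would lead down to
  \<open>n\<close> itself, so the absence of cycles of length \<open>2 * n\<close> bounds all even
  monochromatic cycles.\<close>

lemma two_colour_ramsey:
  assumes N: "4 * n \<le> card V"
  shows "has_cycle R (2 * n) \<or> has_cycle B (2 * n)"
proof (rule ccontr)
  assume no: "\<not> ?thesis"
  define M where "M = {l. has_cycle R (2 * l) \<or> has_cycle B (2 * l)}"
  have short: "l < n" if "l \<in> M" for l
  proof (rule ccontr)
    assume "\<not> l < n"
    then have "n \<le> l" by simp
    then show False using that
    proof (induction l rule: dec_induct)
      case base
      then show ?case using no by (simp add: M_def)
    next
      case (step l)
      have "4 \<le> Suc l" "2 * Suc l - 2 = 2 * l" using step.hyps n3 by simp_all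
      then have "l \<in> M"
        using descent[of "Suc l"] blowup.descent[OF swap, of "Suc l"] step.prems by (auto simp: M_def)
      then show ?case by (rule step.IH)
    qed
  qed
  have "finite M" using short by (intro finite_subset[of M "{..<n}"]) auto
  moreover have "2 \<in> M" using four_cycle[OF N] by (simp add: M_def)
  ultimately have Max: "Max M \<in> M" "2 \<le> Max M" "\<And>l. Max M < l \<Longrightarrow> l \<notin> M"
    by (auto intro: Max_in Max_ge simp: leD)
  have "\<not> has_cycle R (2 * l) \<and> \<not> has_cycle B (2 * l)" if "Max M < l" for l
    using Max(3)[OF that] by (simp add: M_def)
  moreover have "Max M < n" using short Max(1) by blast
  moreover have "has_cycle R (2 * Max M) \<or> has_cycle B (2 * Max M)" using Max(1) by (simp add: M_def)
  ultimately show False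
    using not_longest[OF N Max(2)] blowup.not_longest[OF swap N Max(2)] by blast
qed

end

section \<open>Gallai colourings\<close>

locale gallai =
  fixes V :: "'a set" and c :: "'a set \<Rightarrow> nat"
  assumes finV: "finite V"
    and no_rainbow: "\<lbrakk>x \<in> V; y \<in> V; z \<in> V; x \<noteq> y; y \<noteq> z; x \<noteq> z\<rbrakk> \<Longrightarrow>
      c {x, y} = c {y, z} \<or> c {y, z} = c {x, z} \<or> c {x, y} = c {x, z}"
begin

text \<open>The predicate allows for both uses: one colour, \<open>(=) \<delta>\<close>, and all
  colours outside \<open>{r, b}\<close>.\<close>

definition edge_in :: "(nat \<Rightarrow> bool) \<Rightarrow> 'a \<Rightarrow> 'a \<Rightarrow> bool" where
  "edge_in \<Psi> x y \<longleftrightarrow> x \<noteq> y \<and> \<Psi> (c {x, y})"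

abbreviation joint :: "(nat \<Rightarrow> bool) \<Rightarrow> 'a set \<Rightarrow> 'a \<Rightarrow> 'a \<Rightarrow> bool" where
  "joint \<Psi> \<equiv> linked (edge_in \<Psi>)"

lemma edge_in_sym: "edge_in \<Psi> x y \<Longrightarrow> edge_in \<Psi> y x"
  by (auto simp: edge_in_def insert_commute)

lemma joint_sym: "joint \<Psi> X x y \<Longrightarrow> joint \<Psi> X y x"
  by (rule linked_sym[OF edge_in_sym])

text \<open>For a step from \<open>y\<close> to \<open>y'\<close> the edges to \<open>z\<close> have
  colours failing \<open>\<Psi>\<close>, while the edge between them satisfies it; a triangle that
  is not rainbow then has equal colours at \<open>z\<close>.\<close>

lemma joint_uniform:
  assumes X: "X \<subseteq> V" and l: "joint \<Psi> X a a'" and z: "z \<in> X" "\<not> joint \<Psi> X a z"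
  shows "c {a, z} = c {a', z}"
  using l
proof (induction rule: linked_induct)
  case (step y y')
  have ay': "joint \<Psi> X a y'"
    by (rule linked_trans[OF step.hyps(1)], rule linked_step) (fact step.hyps)+
  have n: "z \<noteq> y \<and> \<not> \<Psi> (c {y, z})" if "y \<in> X" "joint \<Psi> X a y" for y
  proof -
    have "\<not> joint \<Psi> X y z" using z(2) linked_trans[OF that(2)] by blast
    then have "y \<noteq> z" "\<not> edge_in \<Psi> y z"
      using linked_step[of y X z "edge_in \<Psi>"] that(1) z(1) by auto
    then show ?thesis by (simp add: edge_in_def)
  qed
  have "z \<noteq> y" "z \<noteq> y'" "\<not> \<Psi> (c {y, z})" "\<not> \<Psi> (c {y', z})"
    using n[OF step.hyps(2,1)] n[OF step.hyps(3) ay'] by simp_all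
  moreover have "y \<noteq> y'" "\<Psi> (c {y, y'})" using step.hyps(4) by (auto simp: edge_in_def)
  moreover have "y \<in> V" "y' \<in> V" "z \<in> V" using step.hyps(2,3) z(1) X by blast+
  ultimately have "c {y', z} = c {y, z}" using no_rainbow[of y y' z] by metis
  then show ?case using step.IH by simp
qed simp

text \<open>Remove a vertex \<open>v\<close> and let \<open>\<delta>\<close> be a colour not connecting the rest.  If all three
  colours connect \<open>X\<close>, then \<open>v\<close> reaches every \<open>\<delta>\<close>-component in colour \<open>\<delta>\<close>, so
  a neighbour of \<open>v\<close> in another colour forces that colour on all edges leaving its
  component; the two other colours then contradict each other.\<close>

lemma three_colours:
  assumes "X \<subseteq> V" "2 \<le> card X" and abc: "\<alpha> \<noteq> \<beta>" "\<beta> \<noteq> \<gamma>" "\<alpha> \<noteq> \<gamma>"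
  shows "\<exists>\<delta> \<in> {\<alpha>, \<beta>, \<gamma>}. \<exists>x \<in> X. \<exists>y \<in> X. \<not> joint ((=) \<delta>) X x y"
  using assms(1,2)
proof (induction "card X" arbitrary: X rule: less_induct)
  case less
  show ?case
  proof (rule ccontr)
    assume "\<not> ?case"
    then have con: "joint ((=) \<delta>) X x y" if "\<delta> \<in> {\<alpha>, \<beta>, \<gamma>}" "x \<in> X" "y \<in> X" for \<delta> x y
      using that by blast
    have finX: "finite X" using less.prems finV finite_subset by blast
    obtain v where v: "v \<in> X" using less.prems by fastforce
    define X' where "X' = X - {v}"
    have X': "X' \<subseteq> X" "X' \<subseteq> V" "v \<notin> X'" using less.prems by (auto simp: X'_def)
    have cX': "card X' = card X - 1" using v finX by (simp add: X'_def)
    have nbr: "\<exists>y \<in> X'. c {v, y} = \<delta>" if "\<delta> \<in> {\<alpha>, \<beta>, \<gamma>}" for \<delta>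
    proof -
      have "X' \<noteq> {}" using cX' less.prems(2) by auto
      then obtain x where x: "x \<in> X'" by blast
      then have "x \<notin> {v}" "x \<in> X" using X' by auto
      then show ?thesis using linked_exit[OF con[OF that v] singletonI] by (fastforce simp: edge_in_def X'_def)
    qed
    have reach: "\<exists>z \<in> X'. joint ((=) \<delta>) X' u z \<and> c {v, z} = \<delta>"
      if d: "\<delta> \<in> {\<alpha>, \<beta>, \<gamma>}" and u: "u \<in> X'" for \<delta> u
    proof -
      let ?N = "{w \<in> X'. joint ((=) \<delta>) X' u w}"
      have uv: "joint ((=) \<delta>) X u v" using con[OF d] u v X' by blast
      have N: "u \<in> ?N" "v \<notin> ?N" using u X' by auto
      obtain p q where pq: "p \<in> ?N" "q \<notin> ?N" "q \<in> X" "edge_in ((=) \<delta>) p q"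
        using linked_exit[OF uv N] by blast
      have "q = v"
      proof (rule ccontr)
        assume "q \<noteq> v"
        then have "q \<in> X'" using pq(3) by (simp add: X'_def)
        then have "joint ((=) \<delta>) X' u q"
          using pq(1,4) linked_trans linked_step[of p X' q "edge_in ((=) \<delta>)"] by fast
        then show False using pq(2) \<open>q \<in> X'\<close> by blast
      qed
      then show ?thesis using pq by (auto simp: edge_in_def insert_commute)
    qed
    have "2 \<le> card X'"
    proof (rule ccontr)
      assume "\<not> 2 \<le> card X'"
      then have "card X' = 1" using cX' less.prems(2) by simp
      then obtain a where "X' = {a}" by (rule card_1_singletonE)
      then show False using nbr[of \<alpha>] nbr[of \<beta>] abc by auto
    qed
    then have "\<exists>\<delta> \<in> {\<alpha>, \<beta>, \<gamma>}. \<exists>x \<in> X'. \<exists>y \<in> X'. \<not> joint ((=) \<delta>) X' x y"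
      using less.hyps[of X'] cX' X' less.prems(2) by simp
    then obtain \<delta> s t where \<delta>: "\<delta> \<in> {\<alpha>, \<beta>, \<gamma>}" "s \<in> X'" "t \<in> X'" "\<not> joint ((=) \<delta>) X' s t" by blast
    let ?L = "joint ((=) \<delta>) X'"
    obtain \<epsilon> \<zeta> where ez: "\<epsilon> \<in> {\<alpha>, \<beta>, \<gamma>}" "\<zeta> \<in> {\<alpha>, \<beta>, \<gamma>}" "\<epsilon> \<noteq> \<zeta>" "\<epsilon> \<noteq> \<delta>" "\<zeta> \<noteq> \<delta>"
      using \<delta>(1) abc by auto
    have far: "c {x, w} = \<epsilon>" if x: "x \<in> X'" "c {v, x} = \<epsilon>" and \<epsilon>: "\<epsilon> \<noteq> \<delta>"
      and w: "w \<in> X'" "\<not> ?L x w" for x w \<epsilon>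
    proof -
      \<comment> \<open>In the triangle \<open>v, x, z\<close> the edges at \<open>v\<close> have
        colours \<open>\<epsilon>\<close> and \<open>\<delta>\<close>, and the third edge joins
        different components, so it has colour \<open>\<epsilon>\<close>. Uniformity carries this
        from \<open>z\<close> to \<open>w\<close>.\<close>
      obtain z where z: "z \<in> X'" "?L w z" "c {v, z} = \<delta>" using reach[OF \<delta>(1) w(1)] by blast
      have nz: "\<not> ?L x z" using w(2) z(2) linked_trans joint_sym by metis
      then have "x \<noteq> z" by auto
      moreover have "c {x, z} \<noteq> \<delta>"
        using nz linked_step[of x X' z "edge_in ((=) \<delta>)"] x(1) z(1) \<open>x \<noteq> z\<close> unfolding edge_in_def by blast
      moreover have "v \<noteq> x" "v \<noteq> z" using x(1) z(1) X' by auto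
      moreover have "v \<in> V" "x \<in> V" "z \<in> V" using v x(1) z(1) X' less.prems(1) by blast+
      ultimately have "c {x, z} = \<epsilon>"
        using no_rainbow[of v x z] x(2) z(3) \<epsilon> by auto
      moreover have "c {w, x} = c {z, x}"
        using joint_uniform[OF X'(2) z(2) x(1)] w(2) joint_sym by blast
      ultimately show ?thesis by (simp add: insert_commute)
    qed
    obtain x where x: "x \<in> X'" "c {v, x} = \<epsilon>" using nbr ez by blast
    obtain y where y: "y \<in> X'" "c {v, y} = \<zeta>" using nbr ez by blast
    show False
    proof (cases "?L x y")
      case True
      obtain w where w: "w \<in> X'" "\<not> ?L x w" using \<delta> linked_trans joint_sym by metis
      have "\<not> ?L y w" using True w(2) linked_trans by metis
      then have "c {x, w} = \<epsilon>" "c {y, w} = \<zeta>" using far x y w ez by blast+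
      moreover have "c {x, w} = c {y, w}" using joint_uniform[OF X'(2) True w] .
      ultimately show False using ez by simp
    next
      case False
      then have "\<not> ?L y x" using joint_sym by blast
      then have "c {x, y} = \<epsilon>" "c {y, x} = \<zeta>" using far x y ez False by blast+
      then show False using ez by (simp add: insert_commute)
    qed
  qed
qed

text \<open>When at least three colours occur, one of them, \<open>\<delta>\<close>, does not
  connect \<open>X\<close>. Contracting its components to representatives leaves at least two
  vertices, but fewer than before because \<open>\<delta>\<close> occurs, and a cut of the
  contraction lifts back to \<open>X\<close>.\<close>

lemma two_colour_cut:
  assumes "X \<subseteq> V" "2 \<le> card X"
  shows "\<exists>r b. r \<noteq> b \<and> (\<exists>x \<in> X. \<exists>y \<in> X. \<not> joint (\<lambda>i. i \<notin> {r, b}) X x y)"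
  using assms
proof (induction "card X" arbitrary: X rule: less_induct)
  case less
  have finX: "finite X" using less.prems finV finite_subset by blast
  define Cs where "Cs = {c {x, y} | x y. x \<in> X \<and> y \<in> X \<and> x \<noteq> y}"
  obtain T where "T \<subseteq> X" "card T = 2" using less.prems(2) by (rule obtain_subset_with_card_n)
  then obtain x0 y0 where xy0: "x0 \<in> X" "y0 \<in> X" "x0 \<noteq> y0" unfolding card_2_iff by blast
  show ?case
  proof (cases "\<exists>r b. r \<noteq> b \<and> Cs \<subseteq> {r, b}")
    case True
    then obtain r b where rb: "r \<noteq> b" "Cs \<subseteq> {r, b}" by blast
    have "\<not> joint (\<lambda>i. i \<notin> {r, b}) X x0 y0"
    proof
      assume "joint (\<lambda>i. i \<notin> {r, b}) X x0 y0"
      then obtain p q where "p \<in> X" "q \<in> X" "edge_in (\<lambda>i. i \<notin> {r, b}) p q"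
        using linked_exit[of _ X x0 y0 "{x0}"] xy0 by blast
      then show False using rb(2) by (auto simp: edge_in_def Cs_def)
    qed
    then show ?thesis using rb(1) xy0 by blast
  next
    case False
    have "c {x0, y0} \<in> Cs" using xy0 by (auto simp: Cs_def)
    then obtain \<alpha> where \<alpha>: "\<alpha> \<in> Cs" by blast
    \<comment> \<open>\<open>Suc \<alpha>\<close> is merely some colour different from
      \<open>\<alpha>\<close>.\<close>
    have "\<not> Cs \<subseteq> {\<alpha>, Suc \<alpha>}" using False by (metis n_not_Suc_n)
    then obtain \<beta> where \<beta>: "\<beta> \<in> Cs" "\<alpha> \<noteq> \<beta>" by blast
    have "\<not> Cs \<subseteq> {\<alpha>, \<beta>}" using False \<beta> by metis
    then obtain \<gamma> where \<gamma>: "\<gamma> \<in> Cs" "\<alpha> \<noteq> \<gamma>" "\<beta> \<noteq> \<gamma>" by blast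
    obtain \<delta> s t where \<delta>: "\<delta> \<in> {\<alpha>, \<beta>, \<gamma>}" and st: "s \<in> X" "t \<in> X" "\<not> joint ((=) \<delta>) X s t"
      using three_colours[OF less.prems \<beta>(2) \<gamma>(3,2)] by blast
    let ?L = "joint ((=) \<delta>) X"
    define \<rho> where "\<rho> u = (SOME w. ?L u w)" for u
    have L\<rho>: "?L u (\<rho> u)" for u unfolding \<rho>_def by (rule someI[of _ u]) simp
    have \<rho>_eq: "\<rho> u = \<rho> w" if "?L u w" for u w
    proof -
      have "?L u x \<longleftrightarrow> ?L w x" for x
        using linked_trans[OF that] linked_trans[OF joint_sym[OF that]] by blast
      then have "?L u = ?L w" by blast
      then show ?thesis by (simp add: \<rho>_def)
    qed
    have \<rho>_L: "?L u w" if "\<rho> u = \<rho> w" for u w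
      using that L\<rho>[of u] L\<rho>[of w] linked_trans joint_sym by metis
    have \<rho>X: "\<rho> u \<in> X" if "u \<in> X" for u using L\<rho>[of u] linked_in that by metis
    define X' where "X' = \<rho> ` X"
    have X': "X' \<subseteq> X" using \<rho>X by (auto simp: X'_def)
    have \<rho>_id: "\<rho> u = u" if "u \<in> X'" for u
      using that \<rho>_eq[OF L\<rho>] by (auto simp: X'_def)
    obtain x y where xy: "x \<in> X" "y \<in> X" "x \<noteq> y" "c {x, y} = \<delta>"
      using \<delta> \<alpha> \<beta> \<gamma> unfolding Cs_def by blast
    then have "?L x y" by (intro linked_step) (auto simp: edge_in_def)
    then have "\<not> inj_on \<rho> X" using \<rho>_eq xy by (auto simp: inj_on_def)
    then have "card X' < card X"
      unfolding X'_def using finX by (metis card_image_le eq_card_imp_inj_on le_neq_implies_less)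
    moreover have "2 \<le> card X'"
    proof -
      have "\<rho> s \<noteq> \<rho> t" using \<rho>_L st by blast
      then have "card {\<rho> s, \<rho> t} = 2" by simp
      then show ?thesis using card_mono[of X' "{\<rho> s, \<rho> t}"] finX st by (auto simp: X'_def)
    qed
    ultimately obtain r b x' y' where rb: "r \<noteq> b" and xy': "x' \<in> X'" "y' \<in> X'"
        and no: "\<not> joint (\<lambda>i. i \<notin> {r, b}) X' x' y'"
      using less.hyps[of X'] X' less.prems(1) by blast
    let ?\<Psi> = "\<lambda>i. i \<notin> {r, b}"
    \<comment> \<open>An edge between two components has the same colour as the edge between their
      representatives, so walks in \<open>X\<close> project to \<open>X'\<close>.\<close>
    have proj: "joint ?\<Psi> X' (\<rho> x') (\<rho> y)" if "joint ?\<Psi> X x' y" for y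
      using that
    proof (induction rule: linked_induct)
      case (step y z)
      have "joint ?\<Psi> X' (\<rho> y) (\<rho> z)"
      proof (cases "\<rho> y = \<rho> z")
        case False
        then have nl: "\<not> ?L y z" using \<rho>_eq by blast
        have "c {y, z} = c {\<rho> y, z}" using joint_uniform[OF less.prems(1) L\<rho> step.hyps(3) nl] .
        moreover have "c {z, \<rho> y} = c {\<rho> z, \<rho> y}"
        proof (rule joint_uniform[OF less.prems(1) L\<rho> \<rho>X[OF step.hyps(2)]])
          show "\<not> ?L z (\<rho> y)" using nl L\<rho>[of y] linked_trans joint_sym by metis
        qed
        ultimately have "c {\<rho> y, \<rho> z} = c {y, z}" by (simp add: insert_commute)
        then show ?thesis using step.hyps False by (intro linked_step) (auto simp: edge_in_def X'_def)
      qed simp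
      then show ?case using step.IH linked_trans by metis
    qed simp
    have "\<not> joint ?\<Psi> X x' y'" using proj[of y'] no \<rho>_id xy' by auto
    then show ?thesis using rb xy' X' by blast
  qed
qed

end

lemma has_cycle_mono:
  assumes "has_cycle R L" "\<And>x y. R x y \<Longrightarrow> R' x y"
  shows "has_cycle R' L"
proof -
  obtain xs where "xs \<noteq> []" "distinct xs" "successively R xs" "R (last xs) (hd xs)" "length xs = L"
    using assms(1) unfolding has_cycle_def cyclic_list_def by blast
  moreover from this have "successively R' xs" using assms(2) by (blast intro: successively_mono)
  ultimately show ?thesis using assms(2) unfolding has_cycle_def cyclic_list_def by blast
qed

text \<open>Either every component of the non-red relation has fewer than \<open>n\<close> vertices
  and so misses at least \<open>n\<close>, or a larger one is connected in blue. Applied in both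
  orders, this shows that \<open>r\<close> and \<open>b\<close> are large.\<close>

lemma (in blowup) cycle_or_large_component:
  assumes N: "2 * n + 2 \<le> card V"
  shows "has_cycle R (2 * n) \<or> (\<exists>K \<subseteq> V. n \<le> card K \<and> (\<forall>x \<in> K. \<forall>y \<in> K. linked B K x y))"
proof (rule ccontr)
  assume no: "\<not> ?thesis"
  let ?E = "\<lambda>x y. \<not> R x y"
  have "has_cycle R (2 * n)"
  proof (rule has_cycle_components[OF finV, of n ?E])
    fix u assume u: "u \<in> V"
    define K where "K = {v \<in> V. linked ?E V u v}"
    have "\<not> n \<le> card K"
      using no blowup.component_linked[OF swap subset_refl u K_def] by (auto simp: K_def)
    moreover have "card V = card (K \<union> {v \<in> V. \<not> linked ?E V u v})"
      by (rule arg_cong[of _ _ card]) (auto simp: K_def)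
    moreover have "card (K \<union> {v \<in> V. \<not> linked ?E V u v}) \<le> card K + card {v \<in> V. \<not> linked ?E V u v}"
      by (rule card_Un_le)
    ultimately show "n \<le> card {v \<in> V. \<not> linked ?E V u v}" using N by linarith
  qed (use N n3 R_sym in auto)
  then show False using no by blast
qed

section \<open>The smallest homogeneous set and the blow-up around it\<close>

context gallai
begin

definition colour_edge :: "nat \<Rightarrow> 'a \<Rightarrow> 'a \<Rightarrow> bool" where
  "colour_edge i x y \<longleftrightarrow> x \<in> V \<and> y \<in> V \<and> x \<noteq> y \<and> c {x, y} = i"

text \<open>These are the modules of the coloured complete graph.\<close>

definition homogeneous :: "'a set \<Rightarrow> bool" where
  "homogeneous X \<longleftrightarrow> X \<subseteq> V \<and> (\<forall>z \<in> V - X. \<forall>x \<in> X. \<forall>y \<in> X. c {z, x} = c {z, y})"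

definition joined :: "'a set \<Rightarrow> nat \<Rightarrow> 'a set" where
  "joined X i = {z \<in> V - X. \<forall>x \<in> X. c {z, x} = i}"

lemma component_homogeneous:
  assumes X: "homogeneous X" and u: "u \<in> X"
  shows "homogeneous {w \<in> X. joint \<Psi> X u w}"
  unfolding homogeneous_def
proof (intro conjI ballI)
  have XV: "X \<subseteq> V" using X by (simp add: homogeneous_def)
  show "{w \<in> X. joint \<Psi> X u w} \<subseteq> V" using XV by blast
  fix z x y
  assume z: "z \<in> V - {w \<in> X. joint \<Psi> X u w}"
    and x: "x \<in> {w \<in> X. joint \<Psi> X u w}" and y: "y \<in> {w \<in> X. joint \<Psi> X u w}"
  show "c {z, x} = c {z, y}"
  proof (cases "z \<in> X")
    case True
    then have nz: "\<not> joint \<Psi> X u z" using z by blast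
    have "c {u, z} = c {w, z}" if "joint \<Psi> X u w" for w
      using joint_uniform[OF XV that True nz] .
    then have "c {x, z} = c {y, z}" using x y by (metis (no_types, lifting) mem_Collect_eq)
    then show ?thesis by (simp add: insert_commute)
  qed (use X x y z in \<open>auto simp: homogeneous_def\<close>)
qed

lemma joined_colour:
  assumes "x \<in> X" "X \<subseteq> V" "y \<in> joined X r" "z \<in> joined X b" "r \<noteq> b"
  shows "c {y, z} \<in> {r, b}"
proof -
  have "c {y, x} = r" "c {z, x} = b" "y \<noteq> z" "y \<noteq> x" "x \<noteq> z" "x \<in> V" "y \<in> V" "z \<in> V"
    using assms by (auto simp: joined_def)
  then show ?thesis using no_rainbow[of y x z] assms(5) by (auto simp: insert_commute)
qed

lemma parts_closed:
  assumes X: "X \<subseteq> V" "X \<noteq> {}" and rb: "r \<noteq> b"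
    and Z: "Z \<in> {X, joined X r, joined X b}" "u \<in> Z"
    and l: "joint (\<lambda>i. i \<notin> {r, b}) (X \<union> joined X r \<union> joined X b) u w"
  shows "w \<in> Z"
  using l
proof (induction rule: linked_induct)
  case (step y z)
  obtain x where x: "x \<in> X" using X by blast
  have n: "c {y, z} \<notin> {r, b}" using step.hyps(4) by (simp add: edge_in_def)
  have 1: "c {s, t} \<in> {r, b}" "c {t, s} \<in> {r, b}" if "s \<in> X" "t \<in> joined X r \<union> joined X b" for s t
    using that by (auto simp: joined_def insert_commute)
  have 2: "c {s, t} \<in> {r, b}" "c {t, s} \<in> {r, b}" if "s \<in> joined X r" "t \<in> joined X b" for s t
    using joined_colour[OF x X(1) that rb] by (simp_all add: insert_commute)
  have "z \<in> X" if "y \<in> X" using 1(1)[OF that] step.hyps(3) n by blast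
  moreover have "z \<in> joined X r" if "y \<in> joined X r"
    using 1(2)[of z y] 2(1)[OF that, of z] that step.hyps(3) n by blast
  moreover have "z \<in> joined X b" if "y \<in> joined X b"
    using 1(2)[of z y] 2(2)[OF _ that, of z] that step.hyps(3) n by blast
  ultimately show ?case using Z(1) step.IH by blast
qed (rule Z(2))

text \<open>Discarding the edges of colours \<open>r\<close> and \<open>b\<close> inside a component
  makes the components exactly the classes of non-adjacency; the twin property is
  \<open>joint_uniform\<close>.\<close>

lemma parts_blowup:
  assumes Y: "Y \<subseteq> V" and n: "3 \<le> n"
    and small: "\<And>u. u \<in> Y \<Longrightarrow> card {w \<in> Y. joint (\<lambda>i. i \<notin> {r, b}) Y u w} < n"
  defines "E \<equiv> \<lambda>i x y. x \<in> Y \<and> y \<in> Y \<and> \<not> joint (\<lambda>i. i \<notin> {r, b}) Y x y \<and> c {x, y} = i"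
  shows "blowup Y (E r) (E b) n"
proof
  let ?L = "joint (\<lambda>i. i \<notin> {r, b}) Y"
  have same: "?L x y" if "x \<in> Y" "y \<in> Y" "\<not> E r x y" "\<not> E b x y" for x y
  proof (rule ccontr)
    assume no: "\<not> ?L x y"
    then have "x \<noteq> y" by auto
    moreover have "c {x, y} \<notin> {r, b}" using that no by (auto simp: E_def)
    ultimately have "?L x y" using that by (intro linked_step) (auto simp: edge_in_def)
    then show False using no by blast
  qed
  have twin: "E i x z \<longleftrightarrow> E i y z" if xy: "x \<in> Y" "y \<in> Y" "\<not> E r x y" "\<not> E b x y" for i x y z
  proof -
    have l: "?L x y" using same[OF xy] .
    have "?L x z \<longleftrightarrow> ?L y z" using linked_trans[OF l] linked_trans[OF joint_sym[OF l]] by blast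
    moreover have "c {x, z} = c {y, z}" if "z \<in> Y" "\<not> ?L x z"
      using joint_uniform[OF Y l that] .
    ultimately show ?thesis using xy unfolding E_def by metis
  qed
  show "E r u w \<longleftrightarrow> E r v w" "E b u w \<longleftrightarrow> E b v w"
    if "u \<in> Y" "v \<in> Y" "\<not> E r u v" "\<not> E b u v" for u v w
    using twin[OF that] by blast+
  have Esym: "E i x y \<Longrightarrow> E i y x" for i x y
    using joint_sym unfolding E_def by (metis insert_commute)
  show "E r u v \<Longrightarrow> E r v u" "E b u v \<Longrightarrow> E b v u" for u v by (erule Esym)+
  show "card {v \<in> Y. \<not> E r u v \<and> \<not> E b u v} < n" if "u \<in> Y" for u
  proof -
    have "card {v \<in> Y. \<not> E r u v \<and> \<not> E b u v} \<le> card {w \<in> Y. ?L u w}"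
      using same that finite_subset[OF Y finV] by (intro card_mono) auto
    then show ?thesis using small[OF that] by simp
  qed
  show "finite Y" using Y finV finite_subset by blast
qed (use n in \<open>auto simp: E_def\<close>)

text \<open>The hypothesis \<open>large\<close> stands in for connected components: any set of at
  least \<open>n\<close> vertices linked in colour \<open>i\<close> certifies
  \<open>i \<in> L\<close>.\<close>

lemma large_colour_bound:
  assumes n: "3 \<le> n" and L: "finite L"
    and large: "\<And>i K. K \<subseteq> V \<Longrightarrow> n \<le> card K \<Longrightarrow> (\<And>x y. x \<in> K \<Longrightarrow> y \<in> K \<Longrightarrow> linked (colour_edge i) K x y) \<Longrightarrow> i \<in> L"
    and card: "(n - 1) * card L + 2 * n + 2 \<le> card V"
  shows "\<exists>i. has_cycle (colour_edge i) (2 * n)"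
proof (rule ccontr)
  assume "\<not> ?thesis"
  then have no: "\<not> has_cycle (colour_edge i) (2 * n)" for i by blast
  have "homogeneous V" by (simp add: homogeneous_def)
  moreover have "n \<le> card V" using card by simp
  ultimately obtain X where X: "homogeneous X" "n \<le> card X"
      and least: "\<And>X'. homogeneous X' \<Longrightarrow> n \<le> card X' \<Longrightarrow> card X \<le> card X'"
    using ex_has_least_nat[of "\<lambda>X. homogeneous X \<and> n \<le> card X" V card] by blast
  have uni: "c {z, x} = c {z, y}" if "z \<in> V - X" "x \<in> X" "y \<in> X" for x y z
    using X(1) that unfolding homogeneous_def by blast
  have XV: "X \<subseteq> V" using X(1) by (simp add: homogeneous_def)
  have finX: "finite X" using XV finV finite_subset by blast
  have X_ne: "X \<noteq> {}" using X(2) n by auto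
  then obtain x1 where x1: "x1 \<in> X" by blast
  obtain r b x0 y0 where rb: "r \<noteq> b" and xy0: "x0 \<in> X" "y0 \<in> X"
      "\<not> joint (\<lambda>i. i \<notin> {r, b}) X x0 y0"
    using two_colour_cut[OF XV] X(2) n by force
  let ?\<Psi> = "\<lambda>i. i \<notin> {r, b}"
  let ?S = "joined X"
  have finS: "finite (?S i)" for i using finV by (simp add: joined_def)
  have cardS: "card (?S i) \<le> n - 1" for i
  proof (rule ccontr)
    assume "\<not> ?thesis"
    then have "has_cycle (colour_edge i) (2 * n)"
      using X(2) n XV
      by (intro has_cycle_bipartite[of X "?S i"]) (auto simp: joined_def colour_edge_def insert_commute)
    then show False using no by blast
  qed
  define J where "J = {i. ?S i \<noteq> {}}"
  have JL: "J \<subseteq> L"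
  proof
    fix i assume "i \<in> J"
    then obtain z where z: "z \<in> ?S i" by (auto simp: J_def)
    \<comment> \<open>A single \<open>z\<close> joined to all of \<open>X\<close> in colour
      \<open>i\<close> already connects \<open>X\<close> in that colour.\<close>
    have e: "colour_edge i z x" "colour_edge i x z" if "x \<in> X" for x
      using z that XV by (auto simp: joined_def colour_edge_def insert_commute)
    show "i \<in> L"
    proof (rule large[of "insert z X"])
      show "insert z X \<subseteq> V" using z XV by (auto simp: joined_def)
      show "n \<le> card (insert z X)" using X(2) finX card_insert_le[of X z] by linarith
      fix x y assume xy: "x \<in> insert z X" "y \<in> insert z X"
      have "linked (colour_edge i) (insert z X) x z" if "x \<in> insert z X" for x
        using that e(2) linked_step[of x "insert z X" z "colour_edge i"] by auto
      moreover have "linked (colour_edge i) (insert z X) z y" if "y \<in> insert z X" for y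
        using that e(1) linked_step[of z "insert z X" y "colour_edge i"] by auto
      ultimately show "linked (colour_edge i) (insert z X) x y" using xy linked_trans by metis
    qed
  qed
  define Y where "Y = X \<union> ?S r \<union> ?S b"
  have YV: "Y \<subseteq> V" using XV by (auto simp: Y_def joined_def)
  have finY: "finite Y" using YV finV finite_subset by blast
  have finJ: "finite J" using JL L finite_subset by blast
  have cover: "V \<subseteq> Y \<union> (\<Union>i \<in> J - {r, b}. ?S i)"
  proof
    fix z assume z: "z \<in> V"
    show "z \<in> Y \<union> (\<Union>i \<in> J - {r, b}. ?S i)"
    proof (cases "z \<in> X")
      case False
      then have "z \<in> ?S (c {z, x1})" using z uni[of z _ x1] x1 unfolding joined_def by blast
      moreover from this have "c {z, x1} \<in> J" by (auto simp: J_def)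
      ultimately show ?thesis by (cases "c {z, x1} \<in> {r, b}") (auto simp: Y_def)
    qed (simp add: Y_def)
  qed
  have "card V \<le> card (Y \<union> (\<Union>i \<in> J - {r, b}. ?S i))"
    using cover finY finJ finS by (intro card_mono) auto
  also have "\<dots> \<le> card Y + card (\<Union>i \<in> J - {r, b}. ?S i)" by (rule card_Un_le)
  also have "card (\<Union>i \<in> J - {r, b}. ?S i) \<le> (\<Sum>i \<in> J - {r, b}. card (?S i))"
    using finJ by (intro card_UN_le) simp
  also have "\<dots> \<le> card (J - {r, b}) * (n - 1)"
    using sum_bounded_above[of "J - {r, b}" "\<lambda>i. card (?S i)" "n - 1"] cardS by simp
  finally have cV: "card V \<le> card Y + card (J - {r, b}) * (n - 1)" by simp
  have small: "card {w \<in> Y. joint ?\<Psi> Y u w} < n" if u: "u \<in> Y" for u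
  proof (cases "u \<in> X")
    case True
    let ?D = "{w \<in> X. joint ?\<Psi> X u w}"
    have closed: "w \<in> X" if "joint ?\<Psi> Y u w" for w
      using parts_closed[OF XV X_ne rb, of X u w] True that by (simp add: Y_def)
    have "{w \<in> Y. joint ?\<Psi> Y u w} \<subseteq> ?D"
    proof
      fix w assume "w \<in> {w \<in> Y. joint ?\<Psi> Y u w}"
      then have w: "joint ?\<Psi> Y u w" by simp
      have "joint ?\<Psi> {w \<in> Y. joint ?\<Psi> Y u w} u w" by (rule linked_restrict[OF w])
      then have "joint ?\<Psi> X u w"
      proof (rule linked_mono)
        fix x y
        assume "x \<in> {w \<in> Y. joint ?\<Psi> Y u w}" "y \<in> {w \<in> Y. joint ?\<Psi> Y u w}" "edge_in ?\<Psi> x y"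
        then show "joint ?\<Psi> X x y" using closed by (intro linked_step) blast+
      qed
      then show "w \<in> ?D" using closed[OF w] by blast
    qed
    then have "card {w \<in> Y. joint ?\<Psi> Y u w} \<le> card ?D" using finX by (intro card_mono) auto
    moreover have "card ?D < card X"
    proof (rule psubset_card_mono[OF finX])
      have "\<not> (joint ?\<Psi> X u x0 \<and> joint ?\<Psi> X u y0)"
        using xy0(3) linked_trans[OF joint_sym] by blast
      then show "?D \<subset> X" using xy0 by blast
    qed
    then have "card ?D < n" using least[OF component_homogeneous[OF X(1) True, of ?\<Psi>]] by linarith
    ultimately show ?thesis by linarith
  next
    case False
    then obtain i where i: "i \<in> {r, b}" "u \<in> ?S i" using u by (auto simp: Y_def)
    have "{w \<in> Y. joint ?\<Psi> Y u w} \<subseteq> ?S i"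
      using parts_closed[OF XV X_ne rb, of "?S i" u] i unfolding Y_def by auto
    then have "card {w \<in> Y. joint ?\<Psi> Y u w} \<le> card (?S i)" using finS by (intro card_mono)
    then show ?thesis using cardS[of i] n by linarith
  qed
  define E where "E i x y \<longleftrightarrow> x \<in> Y \<and> y \<in> Y \<and> \<not> joint ?\<Psi> Y x y \<and> c {x, y} = i" for i x y
  have E_colour_edge: "colour_edge i x y" if "E i x y" for i x y
    using that YV unfolding E_def colour_edge_def by auto
  have noE: "\<not> has_cycle (E i) (2 * n)" for i
    using has_cycle_mono[of "E i" "2 * n" "colour_edge i"] E_colour_edge no by blast
  interpret Y: blowup Y "E r" "E b" n
    using parts_blowup[OF YV n small] unfolding E_def .
  have largeE: "i \<in> L" if "K \<subseteq> Y" "n \<le> card K" "\<forall>x \<in> K. \<forall>y \<in> K. linked (E i) K x y" for i K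
  proof (rule large)
    show "K \<subseteq> V" using that YV by blast
    show "linked (colour_edge i) K x y" if xy: "x \<in> K" "y \<in> K" for x y
    proof (rule linked_mono)
      show "linked (E i) K x y" using \<open>\<forall>x \<in> K. \<forall>y \<in> K. linked (E i) K x y\<close> xy by blast
    qed (auto intro: linked_step E_colour_edge)
  qed (use that in blast)
  have "card (J - {r, b}) \<le> card L" using JL L by (intro card_mono) auto
  then have "card (J - {r, b}) * (n - 1) \<le> (n - 1) * card L" by simp
  \<comment> \<open>Each colour removed costs at most \<open>n - 1\<close> vertices, and there are
    at most \<open>card L\<close> of them.\<close>
  then have "2 * n + 2 \<le> card Y" using cV card by linarith
  then have "b \<in> L" "r \<in> L"
    using Y.cycle_or_large_component blowup.cycle_or_large_component[OF Y.swap] noE largeE by blast+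
  \<comment> \<open>Now \<open>r\<close> and \<open>b\<close> are known to be among the colours of
    \<open>L\<close> but are not removed, which saves \<open>2 * (n - 1)\<close> vertices:
    \<open>2 * (n - 1) + 2 * n + 2 = 4 * n\<close>.\<close>
  have "card (J - {r, b}) \<le> card (L - {r, b})" using JL L by (intro card_mono) auto
  moreover have "card (L - {r, b}) + 2 = card L"
  proof -
    have "card {r, b} = 2" using rb by simp
    moreover have "{r, b} \<subseteq> L" using \<open>b \<in> L\<close> \<open>r \<in> L\<close> by simp
    ultimately show ?thesis using card_Diff_subset[of "{r, b}" L] card_mono[OF L, of "{r, b}"] by simp
  qed
  ultimately have "card (J - {r, b}) + 2 \<le> card L" by simp
  then have "(n - 1) * (card (J - {r, b}) + 2) \<le> (n - 1) * card L" by (rule mult_le_mono2)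
  then have "card (J - {r, b}) * (n - 1) + 2 * (n - 1) \<le> (n - 1) * card L" by (simp add: algebra_simps)
  then have "4 * n \<le> card Y" using cV card n by linarith
  then show False using Y.two_colour_ramsey noE by blast
qed

end

section \<open>Translation to digraphs\<close>

lemma (in wf_digraph) awalk_of_verts:
  assumes "successively (\<lambda>x y. x \<rightarrow> y) xs" "xs \<noteq> []" "set xs \<subseteq> verts G"
  shows "\<exists>p. awalk (hd xs) p (last xs) \<and> awalk_verts (hd xs) p = xs"
  using assms
proof (induction xs)
  case (Cons x xs)
  show ?case
  proof (cases "xs = []")
    case True
    then show ?thesis using Cons.prems by (intro exI[of _ "[]"]) (simp add: awalk_Nil_iff)
  next
    case False
    then obtain p where p: "awalk (hd xs) p (last xs)" "awalk_verts (hd xs) p = xs"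
      using Cons by (auto simp: successively_Cons)
    have "x \<rightarrow> hd xs" using Cons.prems False by (simp add: successively_Cons)
    then obtain e where "e \<in> arcs G" "tail G e = x" "head G e = hd xs" by (rule reachableE)
    then show ?thesis using p False by (intro exI[of _ "e # p"]) (auto simp: awalk_Cons_iff)
  qed
qed simp

lemma (in wf_digraph) cycle_of_has_cycle:
  assumes "has_cycle (\<lambda>x y. x \<rightarrow> y) L"
  shows "\<exists>p. cycle p \<and> length p = L"
proof -
  obtain xs where xs: "xs \<noteq> []" "distinct xs" "successively (\<lambda>x y. x \<rightarrow> y) xs" "last xs \<rightarrow> hd xs"
      and L: "length xs = L"
    using assms unfolding has_cycle_def cyclic_list_def by blast
  let ?ys = "xs @ [hd xs]"
  have suc: "successively (\<lambda>x y. x \<rightarrow> y) ?ys" using xs by (simp add: successively_append_iff)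
  have "x \<in> verts G" if x: "x \<in> set xs" for x
  proof -
    obtain i where i: "i < length xs" "x = xs ! i" using x by (metis in_set_conv_nth)
    then have "?ys ! i \<rightarrow> ?ys ! Suc i" using successively_nth[OF suc, of i] by simp
    then show ?thesis using i adj_in_verts(1) by (simp add: nth_append)
  qed
  then have "set ?ys \<subseteq> verts G" using xs(1) by auto
  then obtain p where p: "awalk (hd ?ys) p (last ?ys)" "awalk_verts (hd ?ys) p = ?ys"
    using awalk_of_verts[OF suc] by blast
  have len: "length p = L" using length_awalk_verts[of "hd ?ys" p] p(2) L by simp
  have "distinct (tl ?ys)" using xs(1,2) by (cases xs) auto
  moreover have "p \<noteq> []" using len L xs(1) by auto
  moreover have "hd ?ys = last ?ys" using xs(1) by simp
  ultimately have "cycle p" unfolding cycle_def using p by metis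
  then show ?thesis using len by blast
qed

lemma (in sym_digraph) large_scc:
  assumes fin: "finite (verts G)" and x: "x \<in> K" "x \<in> verts G"
    and K: "\<And>y. y \<in> K \<Longrightarrow> linked (\<lambda>x y. x \<rightarrow> y) K x y"
  shows "\<exists>C \<in> sccs. card K \<le> card (verts C)"
proof -
  have "x \<rightarrow>\<^sup>* y" if "y \<in> K" for y
    using K[OF that]
  proof (induction rule: linked_induct)
    case (step y z)
    then show ?case using reachable_adj_trans by blast
  qed (use x in simp)
  then have "K \<subseteq> {y. x \<rightarrow>\<^sup>* y}" by blast
  moreover have "{y. x \<rightarrow>\<^sup>* y} \<subseteq> verts G" by (auto elim: reachable_in_vertsE)
  ultimately have "card K \<le> card {y. x \<rightarrow>\<^sup>* y}" using fin by (meson card_mono finite_subset)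
  then show ?thesis
    using induce_reachable_is_in_sccs[OF x(2)]
    by (intro bexI[of _ "induce_subgraph G {y. x \<rightarrow>\<^sup>* y}"]) simp_all
qed

theorem theorem1p8:
  fixes G :: "('a, 'b) pre_digraph" and c :: "'a set \<Rightarrow> nat" and k n :: nat
  assumes "k \<ge> 1"
    and "n \<ge> 3"
    and "complete_digraph (card (verts G)) G"
    and "card (verts G) \<ge> n"
    and "gallai_coloring G k c"
    and "card (verts G) \<ge> (n - 1) * num_large_colors G k c n + 2 * n + 2"
  shows "monochromatic_cycle G k c (2 * n)"
proof -
  interpret G: graph G using assms(3) by (simp add: complete_digraph_def)
  have adj: "u \<rightarrow>\<^bsub>G\<^esub> v \<longleftrightarrow> u \<in> verts G \<and> v \<in> verts G \<and> u \<noteq> v" for u v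
    using assms(3) by (auto simp: complete_digraph_def)
  interpret gallai "verts G" c
  proof
    fix x y z assume "x \<in> verts G" "y \<in> verts G" "z \<in> verts G" "x \<noteq> y" "y \<noteq> z" "x \<noteq> z"
    then show "c {x, y} = c {y, z} \<or> c {y, z} = c {x, z} \<or> c {x, y} = c {x, z}"
      using assms(5) adj unfolding gallai_coloring_def rainbow_triangle_def by metis
  qed simp
  let ?H = "color_subgraph G c"
  have H_verts: "verts (?H i) = verts G" for i by (simp add: color_subgraph_def)
  have H_adj: "x \<rightarrow>\<^bsub>?H i\<^esub> y \<longleftrightarrow> colour_edge i x y" for i x y
    unfolding arcs_ends_color_subgraph colour_edge_def using adj by auto
  then have H_eq: "(\<lambda>x y. x \<rightarrow>\<^bsub>?H i\<^esub> y) = colour_edge i" for i by blast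
  have H: "sym_digraph (?H i)" for i
  proof -
    interpret H: wf_digraph "?H i"
      using spanning_color_subgraph[OF G.wf_digraph] by (simp add: spanning_def subgraph_def)
    show ?thesis using symmetric_color_subgraph[OF G.sym_arcs] by (rule H.sym_digraphI)
  qed
  have colour: "i \<in> {1..k}" if "colour_edge i x y" for i x y
    using that assms(5) adj unfolding colour_edge_def gallai_coloring_def edge_coloring_in_def by metis
  define L where "L = {i \<in> {1..k}. \<exists>C \<in> pre_digraph.sccs (?H i). n \<le> card (verts C)}"
  have "\<exists>i. has_cycle (colour_edge i) (2 * n)"
  proof (rule large_colour_bound[OF assms(2), of L])
    show "finite L" by (simp add: L_def)
    show "(n - 1) * card L + 2 * n + 2 \<le> card (verts G)"
      using assms(6) by (simp add: num_large_colors_def L_def)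
    fix i K
    assume K: "K \<subseteq> verts G" "n \<le> card K" and lk: "\<And>x y. x \<in> K \<Longrightarrow> y \<in> K \<Longrightarrow> linked (colour_edge i) K x y"
    \<comment> \<open>Two vertices of \<open>K\<close> yield an edge of colour \<open>i\<close>,
      which is needed to place \<open>i\<close> in \<open>{1..k}\<close>.\<close>
    have "2 \<le> card K" using K(2) assms(2) by linarith
    then obtain T where "T \<subseteq> K" "card T = 2" by (rule obtain_subset_with_card_n)
    then obtain x y where xy: "x \<in> K" "y \<in> K" "y \<notin> {x}" unfolding card_2_iff by blast
    then obtain z where "colour_edge i x z" using linked_exit[OF lk[OF xy(1,2)] singletonI xy(3)] by blast
    moreover have "\<exists>C \<in> pre_digraph.sccs (?H i). card K \<le> card (verts C)"
      using xy(1) K(1) lk by (intro sym_digraph.large_scc[OF H]) (auto simp: H_verts H_eq)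
    ultimately show "i \<in> L" using colour K(2) unfolding L_def by fastforce
  qed
  then obtain i where i: "has_cycle (colour_edge i) (2 * n)" by blast
  interpret H: sym_digraph "?H i" by (rule H)
  obtain p where "pre_digraph.cycle (?H i) p" "length p = 2 * n"
    using H.cycle_of_has_cycle[unfolded H_eq, OF i] by blast
  moreover obtain x y where "colour_edge i x y" using i unfolding has_cycle_def cyclic_list_def by blast
  ultimately show ?thesis using colour unfolding monochromatic_cycle_def by blast
qed

end
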